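(* Logical implication is complete for $\Sigma^0_1$ preorders. That is, the relation $\{(\varphi,\psi) : \ \vdash_{FOL}\varphi\to\psi\}$ on formulae of first order logic is a $\Sigma^0_1$ preorder, and for every $\Sigma^0_1$ preorder $P$ on $\mathbb{N}$ there exists a computable function $f$ mapping natural numbers to first order formulae such that for all $x,y\in\mathbb{N}$: $$(x,y)\in P\iff\ \vdash_{FOL} f(x)\to f(y).$$
   Context: First order logic (FOL) is taken with a full relational signature, i.e. with predicate symbols of every arity (as many as needed, computably presented). $\vdash_{FOL}\varphi$ means that $\varphi$ has a proof in first order logic. Formulae are identified with natural numbers via a fixed computable encoding, so relations on formulae are regarded as subsets of $\mathbb{N}\times\mathbb{N}$. A preorder is a reflexive transitive binary relation; a $\Sigma^0_1$ preorder is one that is recursively enumerable as a set of pairs. For binary relations $A,B$ on $\mathbb{N}$, $A\le B$ (computable component-wise reducibility) means that there is a computable $f:\mathbb{N}\to\mathbb{N}$ with $(x,y)\in A\iff (f(x),f(y))\in B$ for all $x,y$. A preorder is complete for $\Sigma^0_1$ preorders if it is $\Sigma^0_1$ and every $\Sigma^0_1$ preorder on $\mathbb{N}$ is $\le$ it. *)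

theory Defs
  imports Main "HOL-Library.Nat_Bijection"
begin

section \<open>Partial recursive functions\<close>

text \<open>
  Programs do not carry an arity; \<open>ev p xs y\<close> says that \<open>p\<close>, run on the argument list \<open>xs\<close>,
  halts with value \<open>y\<close>. A projection beyond the end of the list and a successor of anything
  but a single argument diverge. In primitive recursion
  the recursion argument is the first one, and the step function receives the previous value, the
  recursion argument and the parameters, in this order. In minimisation, the values below the
  least zero are required to be defined.
\<close>

datatype recf =
    Zero
  | Succ
  | Proj nat
  | Comp recf "recf list"
  | PrimRec recf recf
  | Mu recf

inductive ev :: "recf \<Rightarrow> nat list \<Rightarrow> nat \<Rightarrow> bool" where
  ev_Zero: "ev Zero xs 0"
| ev_Succ: "ev Succ [x] (Suc x)"
| ev_Proj: "i < length xs \<Longrightarrow> ev (Proj i) xs (xs ! i)"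
| ev_Comp: "list_all2 (\<lambda>q y. ev q xs y) qs ys \<Longrightarrow> ev p ys z \<Longrightarrow> ev (Comp p qs) xs z"
| ev_PrimRec_0: "ev p xs z \<Longrightarrow> ev (PrimRec p q) (0 # xs) z"
| ev_PrimRec_Suc: "ev (PrimRec p q) (n # xs) y \<Longrightarrow> ev q (y # n # xs) z
    \<Longrightarrow> ev (PrimRec p q) (Suc n # xs) z"
| ev_Mu: "ev p (n # xs) 0 \<Longrightarrow> \<forall>i<n. \<exists>v. ev p (i # xs) (Suc v) \<Longrightarrow> ev (Mu p) xs n"

inductive_cases ev_ZeroE: "ev Zero xs z"
inductive_cases ev_SuccE: "ev Succ xs z"
inductive_cases ev_ProjE: "ev (Proj i) xs z"
inductive_cases ev_CompE: "ev (Comp p qs) xs z"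
inductive_cases ev_PrimRec_0E: "ev (PrimRec p q) (0 # xs) z"
inductive_cases ev_PrimRec_SucE: "ev (PrimRec p q) (Suc n # xs) z"
inductive_cases ev_MuE: "ev (Mu p) xs z"

lemma ev_deterministic: "ev p xs y \<Longrightarrow> ev p xs z \<Longrightarrow> y = z"
proof (induction arbitrary: z rule: ev.induct)
  case (ev_Zero xs)
  then show ?case by (rule ev_ZeroE) simp
next
  case (ev_Succ x)
  then show ?case by (rule ev_SuccE) simp
next
  case (ev_Proj i xs)
  from ev_Proj.prems show ?case by (rule ev_ProjE) simp
next
  case (ev_Comp xs qs ys p w)
  from ev_Comp.prems obtain ys' where
    ys': "list_all2 (\<lambda>q y. ev q xs y) qs ys'" "ev p ys' z"
    by (rule ev_CompE)
  have "ys = ys'"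
  proof (rule nth_equalityI)
    show "length ys = length ys'"
      using ev_Comp.IH(1) ys'(1) by (simp add: list_all2_conv_all_nth)
    show "ys ! i = ys' ! i" if "i < length ys" for i
      using ev_Comp.IH(1) ys'(1) that by (simp add: list_all2_conv_all_nth)
  qed
  then show ?case using ev_Comp.IH(2) ys'(2) by simp
next
  case (ev_PrimRec_0 p xs w q)
  from ev_PrimRec_0.prems have "ev p xs z" by (rule ev_PrimRec_0E)
  then show ?case by (rule ev_PrimRec_0.IH)
next
  case (ev_PrimRec_Suc p q n xs y w)
  from ev_PrimRec_Suc.prems obtain y' where y': "ev (PrimRec p q) (n # xs) y'"
    "ev q (y' # n # xs) z"
    by (rule ev_PrimRec_SucE)
  from ev_PrimRec_Suc.IH(1)[OF y'(1)] y'(2) have "ev q (y # n # xs) z" by simp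
  then show ?case by (rule ev_PrimRec_Suc.IH(2))
next
  case (ev_Mu p n xs)
  from ev_Mu.prems have z: "ev p (z # xs) 0" "\<forall>i<z. \<exists>v. ev p (i # xs) (Suc v)"
    by (auto elim: ev_MuE)
  show ?case
  proof (rule linorder_cases[of n z])
    assume "n < z"
    then obtain v where "ev p (n # xs) (Suc v)" using z(2) by blast
    then have "0 = Suc v" by (rule ev_Mu.IH(1))
    then show ?thesis by simp
  next
    assume "z < n"
    then obtain v where "\<forall>u. ev p (z # xs) u \<longrightarrow> Suc v = u" using ev_Mu.IH(2) by blast
    then have "Suc v = 0" using z(1) by blast
    then show ?thesis by simp
  qed
qed

definition computable :: "(nat \<Rightarrow> nat) \<Rightarrow> bool" where
  "computable f \<longleftrightarrow> (\<exists>p. \<forall>x. ev p [x] (f x))"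

text \<open>A relation is recursively enumerable if it is the domain of a partial recursive function
  of two arguments.\<close>

definition re_rel :: "(nat \<times> nat) set \<Rightarrow> bool" where
  "re_rel A \<longleftrightarrow> (\<exists>p. \<forall>x y. (x, y) \<in> A \<longleftrightarrow> (\<exists>z. ev p [x, y] z))"


section \<open>Preorders and component-wise reducibility\<close>

definition sigma01_preorder :: "(nat \<times> nat) set \<Rightarrow> bool" where
  "sigma01_preorder P \<longleftrightarrow> preorder_on UNIV P \<and> re_rel P"

definition reducible :: "(nat \<times> nat) set \<Rightarrow> (nat \<times> nat) set \<Rightarrow> bool" (infix "\<le>\<^sub>c" 50) where
  "A \<le>\<^sub>c B \<longleftrightarrow> (\<exists>f. computable f \<and> (\<forall>x y. (x, y) \<in> A \<longleftrightarrow> (f x, f y) \<in> B))"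

definition complete_sigma01_preorder :: "(nat \<times> nat) set \<Rightarrow> bool" where
  "complete_sigma01_preorder B \<longleftrightarrow>
     sigma01_preorder B \<and> (\<forall>P. sigma01_preorder P \<longrightarrow> P \<le>\<^sub>c B)"


section \<open>First order logic over the full relational signature\<close>

text \<open>
  Variables are natural numbers; there are no other terms, and there is no equality symbol.
  The predicate symbol of \<open>Atom p vs\<close> is the pair \<open>(p, length vs)\<close>, so there are infinitely many
  predicate symbols of each arity. The remaining connectives and the existential quantifier are
  definable as usual.
\<close>

datatype form =
    Atom nat "nat list"
  | Neg form
  | Imp form form
  | All nat form

fun free_vars :: "form \<Rightarrow> nat set" where
  "free_vars (Atom p vs) = set vs"
| "free_vars (Neg A) = free_vars A"
| "free_vars (Imp A B) = free_vars A \<union> free_vars B"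
| "free_vars (All x A) = free_vars A - {x}"

text \<open>\<open>subst x y A\<close> replaces the free occurrences of \<open>x\<close> by \<open>y\<close> without renaming bound variables;
  \<open>free_for y x A\<close> states that no \<open>y\<close> is captured by this.\<close>

fun subst :: "nat \<Rightarrow> nat \<Rightarrow> form \<Rightarrow> form" where
  "subst x y (Atom p vs) = Atom p (map (\<lambda>v. if v = x then y else v) vs)"
| "subst x y (Neg A) = Neg (subst x y A)"
| "subst x y (Imp A B) = Imp (subst x y A) (subst x y B)"
| "subst x y (All z A) = (if z = x then All z A else All z (subst x y A))"

fun free_for :: "nat \<Rightarrow> nat \<Rightarrow> form \<Rightarrow> bool" where
  "free_for y x (Atom p vs) \<longleftrightarrow> True"
| "free_for y x (Neg A) \<longleftrightarrow> free_for y x A"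
| "free_for y x (Imp A B) \<longleftrightarrow> free_for y x A \<and> free_for y x B"
| "free_for y x (All z A) \<longleftrightarrow> x \<notin> free_vars (All z A) \<or> (z \<noteq> y \<and> free_for y x A)"

text \<open>Mendelson's Hilbert-style calculus.\<close>

inductive provable :: "form \<Rightarrow> bool" ("\<turnstile> _" [50] 50) where
  K: "\<turnstile> Imp A (Imp B A)"
| S: "\<turnstile> Imp (Imp A (Imp B C)) (Imp (Imp A B) (Imp A C))"
| Contra: "\<turnstile> Imp (Imp (Neg B) (Neg A)) (Imp (Imp (Neg B) A) B)"
| Inst: "free_for y x A \<Longrightarrow> \<turnstile> Imp (All x A) (subst x y A)"
| Distr: "x \<notin> free_vars A \<Longrightarrow> \<turnstile> Imp (All x (Imp A B)) (Imp A (All x B))"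
| MP: "\<turnstile> Imp A B \<Longrightarrow> \<turnstile> A \<Longrightarrow> \<turnstile> B"
| Gen: "\<turnstile> A \<Longrightarrow> \<turnstile> All x A"


section \<open>Coding of formulae\<close>

text \<open>The coding is a bijection, so relations on formulae and relations on \<open>nat\<close> are
  interchangeable.\<close>

fun code :: "form \<Rightarrow> nat" where
  "code (Atom p vs) = 4 * prod_encode (p, list_encode vs)"
| "code (Neg A) = 4 * code A + 1"
| "code (Imp A B) = 4 * prod_encode (code A, code B) + 2"
| "code (All x A) = 4 * prod_encode (x, code A) + 3"

lemma inj_code: "inj code"
proof (rule injI)
  define tag :: "form \<Rightarrow> nat" where
    "tag A = (case A of Atom _ _ \<Rightarrow> 0 | Neg _ \<Rightarrow> 1 | Imp _ _ \<Rightarrow> 2 | All _ _ \<Rightarrow> 3)" for A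
  have tag_mod: "tag A = code A mod 4" for A
  proof (cases A)
    case (Atom p vs) then show ?thesis by (simp add: tag_def)
  next
    case (Neg B) then show ?thesis by (simp add: tag_def; presburger)
  next
    case (Imp B C) then show ?thesis by (simp add: tag_def; presburger)
  next
    case (All x B) then show ?thesis by (simp add: tag_def; presburger)
  qed
  have tag_eq: "tag A = tag B" if "code A = code B" for A B
    using that by (simp add: tag_mod)
  show "code A = code B \<Longrightarrow> A = B" for A B
  proof (induction A arbitrary: B)
    case (Atom p vs)
    then show ?case using tag_eq[OF Atom.prems] by (cases B) (auto simp: tag_def list_encode_eq)
  next
    case (Neg A)
    then show ?case using tag_eq[OF Neg.prems] by (cases B) (auto simp: tag_def)
  next
    case (Imp A1 A2)
    then show ?case using tag_eq[OF Imp.prems] by (cases B) (auto simp: tag_def)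
  next
    case (All x A)
    then show ?case using tag_eq[OF All.prems] by (cases B) (auto simp: tag_def)
  qed
qed

lemma surj_code: "surj code"
proof -
  have "\<exists>A. code A = n" for n
  proof (induction n rule: less_induct)
    case (less n)
    define k where "k = n div 4"
    obtain a b where ab: "prod_encode (a, b) = k"
      using surj_prod_encode by (metis surjD surj_pair)
    have le: "a \<le> k" "b \<le> k"
      using ab le_prod_encode_1 le_prod_encode_2 by blast+
    have "n = 4 * k \<or> n = 4 * k + 1 \<or> n = 4 * k + 2 \<or> n = 4 * k + 3"
      unfolding k_def by presburger
    then consider "n = 4 * k" | "n = 4 * k + 1" | "n = 4 * k + 2" | "n = 4 * k + 3"
      by blast
    then show ?case
    proof cases
      case 1
      have "code (Atom a (list_decode b)) = n" using 1 ab by simp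
      then show ?thesis by blast
    next
      case 2
      then obtain A where "code A = k" using less[of k] by auto
      then have "code (Neg A) = n" using 2 by simp
      then show ?thesis by blast
    next
      case 3
      then obtain A B where "code A = a" "code B = b"
        using less[of a] less[of b] le by auto
      then have "code (Imp A B) = n" using 3 ab by simp
      then show ?thesis by blast
    next
      case 4
      then obtain B where "code B = b" using less[of b] le by auto
      then have "code (All a B) = n" using 4 ab by simp
      then show ?thesis by blast
    qed
  qed
  then show ?thesis by (metis surj_def)
qed

lemma bij_code: "bij code"
  by (simp add: bij_def inj_code surj_code)

definition logical_implication :: "(nat \<times> nat) set" where
  "logical_implication = {(code A, code B) | A B. \<turnstile> Imp A B}"

end

theory Submission
  imports Defs "HOL-Library.Countable"
begin

text \<open>
  Provability is recursively enumerable because it is generated, on the level of codes, by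
  finitely many computable rule schemes, which makes it the range of a computable function.

  For hardness, let the program \<open>p\<close> halt exactly on the pairs in the preorder \<open>P\<close>. Evaluation of \<open>p\<close> is axiomatised by
  finitely many Horn clauses in a zero predicate, a successor relation and one predicate for the
  graph of each subprogram; one more clause says that a unary predicate \<open>U\<close> is closed upwards
  under \<open>P\<close>. The formula \<open>f x\<close> is the conjunction of these axioms with the statement that some
  element representing \<open>x\<close> satisfies \<open>U\<close>. If \<open>(x, y) \<in> P\<close>, then \<open>f x\<close> implies \<open>f y\<close> in every structure,
  so the implication is provable by completeness. If not, it fails in the standard model with
  \<open>U = {z. (x, z) \<in> P}\<close>, by reflexivity and transitivity of \<open>P\<close>.
\<close>

section \<open>Computable functions and inductively generated sets\<close>

text \<open>Without function symbols and equality a number can only be described relationally, and a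
  structure may contain many zeros and many successors of an element. The axioms are Horn because
  only positive facts about some representatives can be transported to an arbitrary structure.
  Minimisation would call for a negative premise, namely that there is no earlier zero; a search
  predicate avoids it by recursion, a positive value being one that has a predecessor. The axioms
  occur in both \<open>f x\<close> and \<open>f y\<close>, so the implication may use them and its
  conclusion repeats them at no cost; only the statement about \<open>U\<close> has to be
  transferred. As the calculus never renames bound variables, capture is excluded by parity:
  \<open>f x\<close> is closed and uses odd variables only, which leaves the even ones to serve as
  Henkin constants.\<close>

definition computable2 :: "(nat \<Rightarrow> nat \<Rightarrow> nat) \<Rightarrow> bool" where
  "computable2 h \<longleftrightarrow> (\<exists>p. \<forall>x y. ev p [x, y] (h x y))"

lemma ev_CompI1: "ev q xs y \<Longrightarrow> ev p [y] z \<Longrightarrow> ev (Comp p [q]) xs z"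
  by (rule ev_Comp[where ys = "[y]"]) simp_all

lemma ev_CompI2: "ev q xs y \<Longrightarrow> ev q' xs y' \<Longrightarrow> ev p [y, y'] z \<Longrightarrow> ev (Comp p [q, q']) xs z"
  by (rule ev_Comp[where ys = "[y, y']"]) simp_all

lemma ev_ProjI: "i < length xs \<Longrightarrow> y = xs ! i \<Longrightarrow> ev (Proj i) xs y"
  by (simp add: ev_Proj)

lemma computable_comp: "computable f \<Longrightarrow> computable g \<Longrightarrow> computable (\<lambda>x. f (g x))"
  unfolding computable_def by (blast intro: ev_CompI1)

lemma computable2_comp:
  "computable2 h \<Longrightarrow> computable f \<Longrightarrow> computable g \<Longrightarrow> computable (\<lambda>x. h (f x) (g x))"
  unfolding computable_def computable2_def by (blast intro: ev_CompI2)

lemma computable_id: "computable (\<lambda>x. x)"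
  unfolding computable_def by (rule exI[of _ "Proj 0"]) (simp add: ev_ProjI)

lemma computable_Suc: "computable f \<Longrightarrow> computable (\<lambda>x. Suc (f x))"
  unfolding computable_def by (blast intro: ev_CompI1 ev_Succ)

lemma computable_const: "computable (\<lambda>x. c)"
proof (induction c)
  case 0
  show ?case unfolding computable_def by (blast intro: ev_Zero)
qed (rule computable_Suc)

lemma computable2_add: "computable2 (+)"
proof -
  have "ev (PrimRec (Proj 0) (Comp Succ [Proj 0])) [x, y] (x + y)" for x y
    by (induction x) (auto intro!: ev_PrimRec_0 ev_ProjI ev_CompI1 ev_Succ intro: ev_PrimRec_Suc)
  then show ?thesis unfolding computable2_def by blast
qed

lemma computable2_mult: "computable2 (*)"
proof -
  obtain a where a: "\<And>x y. ev a [x, y] (x + y)"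
    using computable2_add unfolding computable2_def by blast
  have "ev (PrimRec Zero (Comp a [Proj 0, Proj 2])) [x, y] (x * y)" for x y
  proof (induction x)
    case (Suc x)
    show ?case
      by (rule ev_PrimRec_Suc[OF Suc], rule ev_CompI2[where y = "x * y" and y' = y])
        (simp_all add: ev_ProjI a[of "x * y" y, simplified add.commute])
  qed (auto intro: ev_PrimRec_0 ev_Zero)
  then show ?thesis unfolding computable2_def by blast
qed

lemma computable2_diff: "computable2 (-)"
proof -
  have pred: "ev (PrimRec Zero (Proj 1)) [x] (x - 1)" for x
    by (induction x) (auto intro!: ev_PrimRec_0 ev_Zero ev_ProjI intro: ev_PrimRec_Suc)
  \<comment> \<open>Recursion runs on the first argument, so the subtrahend comes first here; the
    projections below swap the arguments back.\<close>
  have "ev (PrimRec (Proj 0) (Comp (PrimRec Zero (Proj 1)) [Proj 0])) [y, x] (x - y)" for x y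
  proof (induction y)
    case (Suc y)
    show ?case
      by (rule ev_PrimRec_Suc[OF Suc], rule ev_CompI1[where y = "x - y"])
        (use pred[of "x - y"] in \<open>simp_all add: ev_ProjI\<close>)
  qed (auto intro!: ev_PrimRec_0 ev_ProjI)
  then have "ev (Comp (PrimRec (Proj 0) (Comp (PrimRec Zero (Proj 1)) [Proj 0])) [Proj 1, Proj 0])
      [x, y] (x - y)" for x y
    by (intro ev_CompI2[where y = y and y' = x]) (simp_all add: ev_ProjI)
  then show ?thesis unfolding computable2_def by blast
qed

lemmas computable_add = computable2_comp[OF computable2_add]
lemmas computable_mult = computable2_comp[OF computable2_mult]
lemmas computable_diff = computable2_comp[OF computable2_diff]

lemma computable_if_eq:
  assumes "computable f" "computable g" "computable a" "computable b"
  shows "computable (\<lambda>x. if f x = g x then a x else b x)"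
proof -
  \<comment> \<open>The symmetric truncated difference vanishes exactly at equality, so
    \<open>?d\<close> is 1 on equality and 0 otherwise.\<close>
  let ?d = "\<lambda>x. 1 - ((f x - g x) + (g x - f x))"
  have "computable (\<lambda>x. a x * ?d x + b x * (1 - ?d x))"
    by (intro computable_add computable_mult computable_diff computable_const assms)
  moreover have "(if f x = g x then a x else b x) = a x * ?d x + b x * (1 - ?d x)" for x
    by auto
  ultimately show ?thesis by simp
qed

lemma computable_rec:
  assumes "computable2 g"
  shows "computable (rec_nat c (\<lambda>n y. g y n))"
proof -
  obtain q where q: "\<And>x y. ev q [x, y] (g x y)" using assms unfolding computable2_def by blast
  \<comment> \<open>When the recursion argument is the only one, the base program runs on the empty
    list.\<close>
  have "\<exists>p. ev p [] c"
  proof (induction c)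
    case 0
    show ?case by (blast intro: ev_Zero)
  next
    case (Suc c)
    then show ?case by (blast intro: ev_CompI1 ev_Succ)
  qed
  then obtain p where p: "ev p [] c" ..
  have "ev (PrimRec p q) [n] (rec_nat c (\<lambda>n y. g y n) n)" for n
    by (induction n) (auto intro: ev_PrimRec_0 ev_PrimRec_Suc p q)
  then show ?thesis unfolding computable_def by blast
qed

lemma computable2_fst:
  assumes "computable f"
  shows "computable2 (\<lambda>x y. f x)"
proof -
  obtain p where "\<And>x. ev p [x] (f x)" using assms unfolding computable_def by blast
  then have "ev (Comp p [Proj 0]) [x, y] (f x)" for x y
    by (intro ev_CompI1[where y = x]) (simp_all add: ev_ProjI)
  then show ?thesis unfolding computable2_def by blast
qed

lemma computable2_snd:
  assumes "computable f"
  shows "computable2 (\<lambda>x y. f y)"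
proof -
  obtain p where "\<And>x. ev p [x] (f x)" using assms unfolding computable_def by blast
  then have "ev (Comp p [Proj 1]) [x, y] (f y)" for x y
    by (intro ev_CompI1[where y = y]) (simp_all add: ev_ProjI)
  then show ?thesis unfolding computable2_def by blast
qed

lemma computable2_comp2:
  assumes "computable2 h" "computable2 f" "computable2 g"
  shows "computable2 (\<lambda>x y. h (f x y) (g x y))"
proof -
  obtain p q r where "\<And>x y. ev p [x, y] (h x y)" "\<And>x y. ev q [x, y] (f x y)"
    "\<And>x y. ev r [x, y] (g x y)"
    using assms unfolding computable2_def by meson
  then have "ev (Comp p [q, r]) [x, y] (h (f x y) (g x y))" for x y by (rule ev_CompI2[rotated 2])
  then show ?thesis unfolding computable2_def by blast
qed

lemma computable_comp2:
  assumes "computable h" "computable2 f"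
  shows "computable2 (\<lambda>x y. h (f x y))"
  using computable2_comp2[OF computable2_fst[OF assms(1)] assms(2) assms(2)] .

section \<open>Computability of Cantor pairing and of its inverse\<close>

lemma computable_triangle: "computable triangle"
proof -
  have "computable (rec_nat 0 (\<lambda>n y. y + Suc n))"
    by (intro computable_rec computable2_comp2[OF computable2_add] computable2_fst computable2_snd
        computable_Suc computable_id)
  moreover have "rec_nat 0 (\<lambda>n y. y + Suc n) = triangle"
  proof
    show "rec_nat 0 (\<lambda>n y. y + Suc n) n = triangle n" for n by (induction n) simp_all
  qed
  ultimately show ?thesis by (rule back_subst[where P = computable])
qed

lemma computable2_prod_encode: "computable2 (\<lambda>x y. prod_encode (x, y))"
proof -
  have "computable2 (\<lambda>x y. triangle (x + y) + x)"
    by (intro computable2_comp2[OF computable2_add] computable_comp2[OF computable_triangle]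
        computable2_add computable2_fst computable_id)
  then show ?thesis by (simp add: prod_encode_def)
qed

lemmas computable_prod_encode = computable2_comp[OF computable2_prod_encode]

abbreviation pi1 :: "nat \<Rightarrow> nat" where "pi1 z \<equiv> fst (prod_decode z)"
abbreviation pi2 :: "nat \<Rightarrow> nat" where "pi2 z \<equiv> snd (prod_decode z)"

lemma triangle_pi: "triangle (pi1 z + pi2 z) + pi1 z = z"
  using prod_decode_inverse[of z]
  by (simp add: prod_encode_def split_beta del: prod_decode_inverse)

text \<open>The sum \<open>s\<close> of the components numbers the diagonal on which
  \<open>z\<close> lies, i.e. \<open>triangle s \<le> z < triangle (Suc s)\<close>. From
  \<open>z\<close> to \<open>Suc z\<close> it grows by one exactly if
  \<open>Suc z = triangle (Suc s)\<close>, which is a primitive recursion without any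
  search.\<close>

lemma computable_pi1_plus_pi2: "computable (\<lambda>z. pi1 z + pi2 z)"
proof -
  let ?g = "\<lambda>s z. s + (1 - (triangle (Suc s) - Suc z))"
  let ?s = "\<lambda>z. pi1 z + pi2 z"
  have d: "computable2 (\<lambda>s z. triangle (Suc s) - Suc z)"
    by (intro computable2_comp2[OF computable2_diff]
        computable2_fst[OF computable_comp[OF computable_triangle]] computable2_snd
        computable_Suc computable_id)
  have "computable2 ?g"
    by (intro computable2_comp2[OF computable2_add computable2_fst[OF computable_id]]
        computable2_comp2[OF computable2_diff computable2_fst[OF computable_const] d])
  then have *: "computable (rec_nat 0 (\<lambda>z s. ?g s z))" by (rule computable_rec)
  have bounds: "triangle (?s z) \<le> z \<and> z < triangle (Suc (?s z))" for z
    using triangle_pi[of z] by simp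
  have mono: "triangle m \<le> triangle n" if "m \<le> n" for m n
    using that by (induction rule: dec_induct) simp_all
  have unique: "s = ?s z" if "triangle s \<le> z" "z < triangle (Suc s)" for s z
  proof (rule ccontr)
    assume "s \<noteq> ?s z"
    then have "Suc s \<le> ?s z \<or> Suc (?s z) \<le> s" by linarith
    then show False using mono bounds[of z] that by (meson leD le_trans not_le)
  qed
  have "rec_nat 0 (\<lambda>z s. ?g s z) z = ?s z" for z
  proof (induction z)
    case 0
    show ?case using unique[of 0 0] by simp
  next
    case (Suc z)
    have "?g s z = ?s (Suc z)" if "triangle s \<le> z" "z < triangle (Suc s)" for s
    proof (cases "triangle (Suc s) = Suc z")
      case True
      then have "?g s z = Suc s" by (simp del: triangle_Suc)
      also have "\<dots> = ?s (Suc z)" using unique[of "Suc s" "Suc z"] True by simp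
      finally show ?thesis .
    next
      case False
      then show ?thesis using unique[of s "Suc z"] that by simp
    qed
    then have "?g (?s z) z = ?s (Suc z)" using bounds[of z] by blast
    then show ?case using Suc by simp
  qed
  then have "rec_nat 0 (\<lambda>z s. ?g s z) = ?s" by (rule ext)
  with * show ?thesis by (rule back_subst[where P = computable])
qed

lemma computable_pi1: "computable f \<Longrightarrow> computable (\<lambda>x. pi1 (f x))"
  and computable_pi2: "computable f \<Longrightarrow> computable (\<lambda>x. pi2 (f x))"
proof -
  let ?s = "\<lambda>z. pi1 z + pi2 z"
  have eq: "pi1 = (\<lambda>z. z - triangle (?s z))"
    using triangle_pi by (intro ext) (metis add_diff_cancel_left')
  have 1: "computable pi1"
    by (subst eq, intro computable_diff computable_id computable_comp[OF computable_triangle]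
        computable_pi1_plus_pi2)
  have "computable (\<lambda>z. ?s z - pi1 z)"
    by (intro computable_diff 1 computable_pi1_plus_pi2)
  then have 2: "computable pi2" by simp
  show "computable f \<Longrightarrow> computable (\<lambda>x. pi1 (f x))" by (rule computable_comp[OF 1])
  show "computable f \<Longrightarrow> computable (\<lambda>x. pi2 (f x))" by (rule computable_comp[OF 2])
qed

lemma computable2I:
  assumes "computable f" "\<And>x y. h x y = f (prod_encode (x, y))"
  shows "computable2 h"
  unfolding assms(2) by (rule computable_comp2[OF assms(1) computable2_prod_encode])

lemmas computable_intros = computable_id computable_const computable_Suc computable_add
  computable_mult computable_diff computable_prod_encode computable_pi1 computable_pi2
  computable_if_eq

lemma computable2_funpow:
  assumes "computable g"
  shows "computable2 (\<lambda>n x. (g ^^ n) x)"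
proof -
  obtain q where q: "\<And>x. ev q [x] (g x)" using assms unfolding computable_def by blast
  have "ev (PrimRec (Proj 0) (Comp q [Proj 0])) [n, x] ((g ^^ n) x)" for n x
    by (induction n) (auto intro!: ev_PrimRec_0 ev_ProjI ev_CompI1 q intro: ev_PrimRec_Suc)
  then show ?thesis unfolding computable2_def by blast
qed

text \<open>\<open>list_encode\<close> codes \<open>x # xs\<close> as the successor of a pair; after
  subtracting 1, \<open>pi1\<close> reads the head and \<open>pi2\<close> the tail.\<close>

definition list_nth :: "nat \<Rightarrow> nat \<Rightarrow> nat" where
  "list_nth l i = pi1 (((\<lambda>l. pi2 (l - 1)) ^^ i) l - 1)"

lemma computable_list_nth:
  assumes "computable f" "computable g"
  shows "computable (\<lambda>x. list_nth (f x) (g x))"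
  unfolding list_nth_def
  by (intro computable_pi1 computable_diff computable_const assms
      computable2_comp[OF computable2_funpow] computable_pi2 computable_id)

lemma list_nth_encode: "i < length xs \<Longrightarrow> list_nth (list_encode xs) i = xs ! i"
proof (induction xs arbitrary: i)
  case (Cons x xs)
  show ?case
  proof (cases i)
    case (Suc j)
    have "list_nth (list_encode (x # xs)) (Suc j) = list_nth (list_encode xs) j"
      unfolding list_nth_def funpow_Suc_right by simp
    then show ?thesis using Cons Suc by simp
  qed (simp add: list_nth_def)
qed simp

text \<open>A triple \<open>(P, Q, C)\<close> is the rule scheme that infers \<open>C w\<close> from \<open>P w\<close> and \<open>Q w\<close>, for every
  parameter \<open>w\<close>. The number \<open>0\<close> serves as a trivial premise and as the conclusion of instances
  that violate a side condition.\<close>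

inductive derivable :: "((nat \<Rightarrow> nat) \<times> (nat \<Rightarrow> nat) \<times> (nat \<Rightarrow> nat)) list \<Rightarrow> nat \<Rightarrow> bool" for R where
  derivable_0: "derivable R 0"
| derivable_rule: "(P, Q, C) \<in> set R \<Longrightarrow> derivable R (P w) \<Longrightarrow> derivable R (Q w) \<Longrightarrow> derivable R (C w)"

text \<open>Merges finitely many functions into one that also takes the index. The default 0 is
  harmless, being derivable: an index beyond the rule list concludes nothing new.\<close>

fun select :: "(nat \<Rightarrow> nat) list \<Rightarrow> nat \<Rightarrow> nat \<Rightarrow> nat" where
  "select [] k w = 0"
| "select (f # fs) k w = (if k = 0 then f w else select fs (k - 1) w)"

lemma computable_select:
  assumes "\<forall>f\<in>set fs. computable f" "computable k" "computable w"
  shows "computable (\<lambda>x. select fs (k x) (w x))"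
  using assms
proof (induction fs arbitrary: k)
  case (Cons f fs)
  have f: "computable f" using Cons.prems by simp
  have fs: "computable (\<lambda>x. select fs (k x - 1) (w x))"
    using Cons.prems by (intro Cons.IH computable_intros) auto
  show ?case unfolding select.simps
    by (intro computable_intros computable_comp[OF f] fs Cons.prems)
qed (simp add: computable_const)

lemma select_nth: "k < length fs \<Longrightarrow> select fs k w = (fs ! k) w"
  by (induction fs arbitrary: k) (auto simp: nth_Cons')

lemma select_ge: "length fs \<le> k \<Longrightarrow> select fs k w = 0"
  by (induction fs arbitrary: k) auto

theorem derivable_enumerable:
  assumes "\<forall>(P, Q, C)\<in>set R. computable P \<and> computable Q \<and> computable C"
  obtains e where "computable e" "\<And>n. derivable R n \<longleftrightarrow> (\<exists>k. e k = n)"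
proof -
  define P where "P k w = select (map fst R) k w" for k w
  define Q where "Q k w = select (map (fst \<circ> snd) R) k w" for k w
  define C where "C k w = select (map (snd \<circ> snd) R) k w" for k w
  have comp: "computable (\<lambda>x. P (f x) (g x))" "computable (\<lambda>x. Q (f x) (g x))"
    "computable (\<lambda>x. C (f x) (g x))" if "computable f" "computable g" for f g
    unfolding P_def Q_def C_def by (intro computable_select that; use assms in fastforce)+
  text \<open>Stage \<open>n\<close> codes a rule, its parameter and the stages of the two premises, which are at
    most \<open>n\<close>. Only the list \<open>h n\<close> of all values up to stage \<open>n\<close> is defined by recursion.\<close>
  define new where "new n h = (let k = pi1 n; w = pi1 (pi2 n); i = pi1 (pi2 (pi2 n));
      j = pi2 (pi2 (pi2 n)) in
    if P k w = list_nth h (n - i) then if Q k w = list_nth h (n - j) then C k w else 0 else 0)"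
    for n h
  define h where "h = rec_nat (list_encode [0]) (\<lambda>n h. Suc (prod_encode (new n h, h)))"
  define e where "e n = list_nth (h n) 0" for n
  have "computable2 (\<lambda>h n. Suc (prod_encode (new n h, h)))"
    unfolding new_def Let_def
    by (rule computable2I[where f = "\<lambda>z. Suc (prod_encode (new (pi2 z) (pi1 z), pi1 z))"])
      (simp_all add: new_def Let_def, intro computable_intros comp computable_list_nth)
  then have comp_h: "computable h" unfolding h_def by (rule computable_rec)
  then have comp_e: "computable e"
    unfolding e_def by (intro computable_list_nth computable_const)
  have h: "h n = list_encode (map e (rev [0..<Suc n]))" for n
  proof (induction n)
    case 0
    show ?case by (simp add: e_def h_def list_nth_def)
  next
    case (Suc n)
    have "h (Suc n) = Suc (prod_encode (new n (h n), h n))" by (simp add: h_def)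
    moreover from this have "e (Suc n) = new n (h n)" by (simp add: e_def list_nth_def)
    ultimately have "h (Suc n) = list_encode (e (Suc n) # map e (rev [0..<Suc n]))" using Suc by simp
    then show ?case by simp
  qed
  \<comment> \<open>The newest value stands first in \<open>h n\<close>, so the value of stage
    \<open>i\<close> is at position \<open>n - i\<close>.\<close>
  have nth: "list_nth (h n) (n - i) = e i" if "i \<le> n" for n i
    unfolding h using that by (subst list_nth_encode) (auto simp: rev_nth simp del: upt_Suc)
  have e0: "e 0 = 0" by (simp add: e_def h_def list_nth_def)
  have e_Suc: "e (Suc n) = (if P k w = e i \<and> Q k w = e j then C k w else 0)"
    if "n = prod_encode (k, prod_encode (w, prod_encode (i, j)))" for n k w i j
  proof -
    have "i \<le> n" "j \<le> n" unfolding that by (meson le_prod_encode_1 le_prod_encode_2 le_trans)+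
    then have ij: "list_nth (h n) (n - i) = e i" "list_nth (h n) (n - j) = e j" by (simp_all add: nth)
    have "pi1 n = k" "pi1 (pi2 n) = w" "pi1 (pi2 (pi2 n)) = i" "pi2 (pi2 (pi2 n)) = j"
      by (simp_all add: that)
    then have "new n (h n) = (if P k w = e i \<and> Q k w = e j then C k w else 0)"
      by (simp add: new_def Let_def ij)
    then show ?thesis by (simp add: e_def h_def list_nth_def)
  qed
  have sound: "derivable R (e n)" for n
  proof (induction n rule: less_induct)
    case (less n)
    show ?case
    proof (cases n)
      case 0
      then show ?thesis by (simp add: e0 derivable_0)
    next
      case (Suc m)
      obtain k w i j where m: "m = prod_encode (k, prod_encode (w, prod_encode (i, j)))"
        by (metis prod.collapse prod_decode_inverse)
      have "i < n" "j < n" unfolding Suc m less_Suc_eq_le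
        by (meson le_prod_encode_1 le_prod_encode_2 le_trans)+
      then have ij: "derivable R (e i)" "derivable R (e j)" using less by auto
      show ?thesis
      proof (cases "k < length R \<and> P k w = e i \<and> Q k w = e j")
        case True
        obtain p q c where R: "R ! k = (p, q, c)" by (cases "R ! k") auto
        then have pqc: "P k w = p w" "Q k w = q w" "C k w = c w" "(p, q, c) \<in> set R"
          using conjunct1[OF True] nth_mem[of k R] by (simp_all add: P_def Q_def C_def select_nth)
        have "derivable R (c w)"
          using derivable_rule[OF pqc(4), of w] ij True pqc(1,2) by simp
        then show ?thesis using True pqc(3) by (simp add: Suc e_Suc[OF m])
      next
        case False
        then have "e n = 0" unfolding Suc e_Suc[OF m] by (auto simp: C_def select_ge)
        then show ?thesis by (simp add: derivable_0)
      qed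
    qed
  qed
  have complete: "\<exists>k. e k = n" if "derivable R n" for n
    using that
  proof induction
    case derivable_0
    show ?case using e0 by blast
  next
    case (derivable_rule p q c w)
    then obtain i j where "e i = p w" "e j = q w" by blast
    moreover obtain k where "k < length R" "R ! k = (p, q, c)"
      using derivable_rule by (metis in_set_conv_nth)
    \<comment> \<open>Any two stages \<open>i\<close>, \<open>j\<close> may be combined, since the
      code of the new stage automatically exceeds both.\<close>
    ultimately have "e (Suc (prod_encode (k, prod_encode (w, prod_encode (i, j))))) = c w"
      by (subst e_Suc[OF refl]) (simp add: P_def Q_def C_def select_nth)
    then show ?case by blast
  qed
  show ?thesis using that comp_e sound complete by blast
qed

text \<open>The pair is accepted by an unbounded search for a stage at which \<open>e\<close> takes
  the wanted value. The test \<open>?d\<close> is total, as minimisation demands of the values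
  before the first zero.\<close>

lemma re_rel_enumerable:
  assumes e: "computable e" and f: "computable f"
  shows "re_rel {(x, y). \<exists>k. e k = f (prod_encode (x, y))}"
proof -
  let ?d = "\<lambda>z. (e (pi1 z) - f (pi2 z)) + (f (pi2 z) - e (pi1 z))"
  have "computable ?d" by (intro computable_intros computable_comp[OF e] computable_comp[OF f])
  then obtain d where d: "\<And>z. ev d [z] (?d z)" unfolding computable_def by blast
  obtain p where p: "\<And>x y. ev p [x, y] (prod_encode (x, y))"
    using computable2_prod_encode unfolding computable2_def by blast
  define q where "q = Comp d [Comp p [Proj 0, Comp p [Proj 1, Proj 2]]]"
  have q: "ev q [k, x, y] (?d (prod_encode (k, prod_encode (x, y))))" for k x y
    unfolding q_def
    by (rule ev_CompI1[OF _ d], rule ev_CompI2[OF _ _ p], simp add: ev_ProjI,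
        rule ev_CompI2[OF _ _ p]) (simp_all add: ev_ProjI)
  have "(\<exists>k. e k = f (prod_encode (x, y))) \<longleftrightarrow> (\<exists>z. ev (Mu q) [x, y] z)" for x y
  proof
    assume "\<exists>k. e k = f (prod_encode (x, y))"
    then obtain k where "e k = f (prod_encode (x, y))" ..
    then have ex: "\<exists>k. ?d (prod_encode (k, prod_encode (x, y))) = 0" by (intro exI[of _ k]) simp
    define k where "k = (LEAST k. ?d (prod_encode (k, prod_encode (x, y))) = 0)"
    have "ev q [k, x, y] 0" using LeastI_ex[OF ex] q[of k x y] unfolding k_def by simp
    moreover have "\<exists>v. ev q [i, x, y] (Suc v)" if "i < k" for i
      using not_less_Least[OF that[unfolded k_def]] q[of i x y] not0_implies_Suc by metis
    ultimately show "\<exists>z. ev (Mu q) [x, y] z" by (blast intro: ev_Mu)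
  next
    assume "\<exists>z. ev (Mu q) [x, y] z"
    then obtain k where "ev q [k, x, y] 0" by (auto elim: ev_MuE)
    then have "?d (prod_encode (k, prod_encode (x, y))) = 0" using q ev_deterministic by blast
    then show "\<exists>k. e k = f (prod_encode (x, y))" by auto
  qed
  then show ?thesis unfolding re_rel_def by blast
qed


section \<open>Soundness and completeness\<close>

fun sem :: "(nat \<Rightarrow> 'd list \<Rightarrow> bool) \<Rightarrow> (nat \<Rightarrow> 'd) \<Rightarrow> form \<Rightarrow> bool" where
  "sem I s (Atom p vs) \<longleftrightarrow> I p (map s vs)"
| "sem I s (Neg A) \<longleftrightarrow> \<not> sem I s A"
| "sem I s (Imp A B) \<longleftrightarrow> (sem I s A \<longrightarrow> sem I s B)"
| "sem I s (All x A) \<longleftrightarrow> (\<forall>d. sem I (s(x := d)) A)"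

lemma sem_cong: "(\<And>v. v \<in> free_vars A \<Longrightarrow> s v = t v) \<Longrightarrow> sem I s A \<longleftrightarrow> sem I t A"
proof (induction A arbitrary: s t)
  case (Atom p vs)
  then have "map s vs = map t vs" by simp
  then show ?case by (simp only: sem.simps)
next
  case (Neg A)
  have "sem I s A \<longleftrightarrow> sem I t A" using Neg.prems by (intro Neg.IH) simp
  then show ?case by simp
next
  case (Imp A B)
  have "sem I s A \<longleftrightarrow> sem I t A" using Imp.prems by (intro Imp.IH) simp
  moreover have "sem I s B \<longleftrightarrow> sem I t B" using Imp.prems by (intro Imp.IH) simp
  ultimately show ?case by simp
next
  case (All x A)
  have "sem I (s(x := d)) A \<longleftrightarrow> sem I (t(x := d)) A" for d
    using All.prems by (intro All.IH) simp
  then show ?case by simp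
qed

lemma subst_not_free: "x \<notin> free_vars A \<Longrightarrow> subst x y A = A"
  by (induction A) (auto intro!: map_idI)

lemma free_for_not_free: "x \<notin> free_vars A \<Longrightarrow> free_for y x A"
  by (induction A) auto

lemma sem_subst: "free_for y x A \<Longrightarrow> sem I s (subst x y A) \<longleftrightarrow> sem I (s(x := s y)) A"
proof (induction A arbitrary: s)
  case (Atom p vs)
  have "map s (map (\<lambda>v. if v = x then y else v) vs) = map (s(x := s y)) vs" by simp
  then show ?case by (simp only: sem.simps subst.simps)
next
  case (All z A)
  show ?case
  proof (cases "z = x")
    case False
    have "sem I s (subst x y (All z A)) \<longleftrightarrow> (\<forall>d. sem I (s(z := d)) (subst x y A))"
      using False by simp
    also have "\<dots> \<longleftrightarrow> (\<forall>d. sem I (s(x := s y, z := d)) A)"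
    proof (cases "x \<in> free_vars A")
      case True
      then have *: "z \<noteq> y" "free_for y x A" using All.prems False by auto
      have eq: "(s(z := d))(x := (s(z := d)) y) = s(x := s y, z := d)" for d
        using False * by auto
      show ?thesis by (simp only: All.IH[OF *(2)] eq)
    next
      case x: False
      show ?thesis unfolding subst_not_free[OF x] using x False by (intro all_cong1 sem_cong) auto
    qed
    finally show ?thesis by (simp only: sem.simps)
  qed (simp only: sem.simps subst.simps refl if_True fun_upd_upd)
qed simp_all

theorem soundness: "\<turnstile> A \<Longrightarrow> sem I s A"
proof (induction arbitrary: s rule: provable.induct)
  case (Inst y x A)
  then show ?case by (simp add: sem_subst)
next
  case (Distr x A B)
  have "sem I (s(x := d)) A \<longleftrightarrow> sem I s A" for d using Distr by (intro sem_cong) auto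
  then show ?case by simp
qed auto

section \<open>Derivability from hypotheses\<close>

lemma provable_refl: "\<turnstile> Imp A A"
  using provable.S[of A "Imp A A" A] provable.K MP by blast

lemma provable_weaken: "\<turnstile> B \<Longrightarrow> \<turnstile> Imp A B"
  using provable.K MP by blast

lemma provable_mp_under: "\<turnstile> Imp A (Imp B C) \<Longrightarrow> \<turnstile> Imp A B \<Longrightarrow> \<turnstile> Imp A C"
  using provable.S MP by blast

lemma provable_trans: "\<turnstile> Imp A B \<Longrightarrow> \<turnstile> Imp B C \<Longrightarrow> \<turnstile> Imp A C"
  using provable_mp_under provable_weaken by blast

text \<open>Generalisation enters only through theorems and is never applied to hypotheses; this
  makes the deduction theorem hold without a side condition.\<close>

inductive entails :: "form set \<Rightarrow> form \<Rightarrow> bool" (infix "\<tturnstile>" 50) for G where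
  hyp: "A \<in> G \<Longrightarrow> G \<tturnstile> A"
| taut: "\<turnstile> A \<Longrightarrow> G \<tturnstile> A"
| mp: "G \<tturnstile> Imp A B \<Longrightarrow> G \<tturnstile> A \<Longrightarrow> G \<tturnstile> B"

lemma entails_provable_mp: "\<turnstile> Imp A B \<Longrightarrow> G \<tturnstile> A \<Longrightarrow> G \<tturnstile> B"
  by (rule entails.mp[OF entails.taut])

lemma entails_empty: "{} \<tturnstile> A \<Longrightarrow> \<turnstile> A"
  by (induction rule: entails.induct) (auto intro: MP)

lemma entails_mono: "G \<tturnstile> A \<Longrightarrow> G \<subseteq> H \<Longrightarrow> H \<tturnstile> A"
  by (induction rule: entails.induct) (auto intro: entails.intros)

lemma deduction: "insert A G \<tturnstile> B \<Longrightarrow> G \<tturnstile> Imp A B"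
proof (induction rule: entails.induct)
  case (hyp B)
  then show ?case using provable_refl provable.K by (metis entails.intros insertE)
next
  case (taut B)
  then show ?case by (intro entails.taut provable_weaken)
next
  case (mp B C)
  then show ?case using provable.S entails.mp entails.taut by metis
qed

lemma entails_finite: "G \<tturnstile> A \<Longrightarrow> \<exists>H. finite H \<and> H \<subseteq> G \<and> H \<tturnstile> A"
proof (induction rule: entails.induct)
  case (hyp A)
  then show ?case by (intro exI[of _ "{A}"]) (auto intro: entails.hyp)
next
  case (taut A)
  then show ?case by (intro exI[of _ "{}"]) (auto intro: entails.taut)
next
  case (mp A B)
  then obtain H K where "finite H" "H \<subseteq> G" "H \<tturnstile> Imp A B" "finite K" "K \<subseteq> G" "K \<tturnstile> A"
    by blast
  then show ?case
    by (intro exI[of _ "H \<union> K"]) (auto intro: entails.mp entails_mono)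
qed

text \<open>Recovers generalisation over variables that are not free in the hypotheses: a hypothesis
  implies its own generalisation by \<open>Distr\<close>, and modus ponens commutes with the
  quantifier.\<close>

lemma entails_All:
  assumes "G \<tturnstile> A" "\<forall>B\<in>G. y \<notin> free_vars B"
  shows "G \<tturnstile> All y A"
  using assms(1)
proof (induction rule: entails.induct)
  case (hyp A)
  then have "y \<notin> free_vars A" using assms(2) by blast
  then have "\<turnstile> Imp A (All y A)" using Distr Gen provable_refl MP by blast
  then show ?case using entails_provable_mp entails.hyp[OF hyp] by blast
next
  case (taut A)
  then show ?case by (intro entails.taut Gen)
next
  case (mp A B)
  have subst_id: "subst y y C = C" "free_for y y C" for C
    by (induction C) (auto intro!: map_idI)
  have "\<turnstile> Imp (All y C) C" for C
    using Inst[of y y C] by (simp add: subst_id)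
  then have inst: "G' \<tturnstile> C" if "G' \<tturnstile> All y C" for G' C
    using that by (rule entails_provable_mp)
  \<comment> \<open>The aim is distribution of the quantifier over an implication;
    \<open>Distr\<close> alone pulls it only past a premise without free \<open>y\<close>, so it is
    applied twice.\<close>
  have "{All y A, All y (Imp A B)} \<tturnstile> B"
    by (rule entails.mp[of _ A]) (auto intro: inst entails.hyp)
  then have "\<turnstile> Imp (All y (Imp A B)) (Imp (All y A) B)"
    by (intro entails_empty deduction)
  then have "\<turnstile> All y (Imp (All y (Imp A B)) (Imp (All y A) B))" by (rule Gen)
  then have "\<turnstile> Imp (All y (Imp A B)) (All y (Imp (All y A) B))"
    by (rule MP[OF Distr, rotated]) simp
  moreover have "\<turnstile> Imp (All y (Imp (All y A) B)) (Imp (All y A) (All y B))" by (rule Distr) simp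
  ultimately have "\<turnstile> Imp (All y (Imp A B)) (Imp (All y A) (All y B))" by (rule provable_trans)
  then have "G \<tturnstile> Imp (All y A) (All y B)" by (rule entails_provable_mp) (rule mp.IH)
  then show ?case by (rule entails.mp) (rule mp.IH)
qed

definition consistent :: "form set \<Rightarrow> bool" where
  "consistent G \<longleftrightarrow> \<not> (\<exists>A. G \<tturnstile> A \<and> G \<tturnstile> Neg A)"

lemma by_contradiction:
  assumes "\<not> consistent (insert (Neg A) G)"
  shows "G \<tturnstile> A"
proof -
  obtain B where "G \<tturnstile> Imp (Neg A) B" "G \<tturnstile> Imp (Neg A) (Neg B)"
    using assms deduction unfolding consistent_def by blast
  then show ?thesis using Contra entails.mp entails.taut by metis
qed

lemma ex_falso: "G \<tturnstile> A \<Longrightarrow> G \<tturnstile> Neg A \<Longrightarrow> G \<tturnstile> B"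
  by (rule by_contradiction) (auto simp: consistent_def intro: entails_mono)

lemma entails_NegI:
  assumes "\<not> consistent (insert A G)"
  shows "G \<tturnstile> Neg A"
proof (rule by_contradiction)
  \<comment> \<open>\<open>Contra\<close> refutes negated assumptions only. Double negation
    elimination makes the contradiction from \<open>A\<close> available under
    \<open>Neg (Neg A)\<close>.\<close>
  have "insert (Neg (Neg A)) G \<tturnstile> A"
  proof (rule by_contradiction)
    show "\<not> consistent (insert (Neg A) (insert (Neg (Neg A)) G))"
      unfolding consistent_def by (auto intro: entails.hyp)
  qed
  moreover obtain B where "G \<tturnstile> Imp A B" "G \<tturnstile> Imp A (Neg B)"
    using assms deduction unfolding consistent_def by blast
  then have "insert (Neg (Neg A)) G \<tturnstile> Imp A B" "insert (Neg (Neg A)) G \<tturnstile> Imp A (Neg B)"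
    by (auto intro: entails_mono)
  ultimately show "\<not> consistent (insert (Neg (Neg A)) G)"
    unfolding consistent_def using entails.mp by blast
qed

section \<open>Capture-free substitution and the Henkin extension\<close>

fun bound_vars :: "form \<Rightarrow> nat set" where
  "bound_vars (Atom p vs) = {}"
| "bound_vars (Neg A) = bound_vars A"
| "bound_vars (Imp A B) = bound_vars A \<union> bound_vars B"
| "bound_vars (All x A) = insert x (bound_vars A)"

lemma finite_free_vars: "finite (free_vars A)"
  by (induction A) auto

lemma free_for_not_bound: "y \<notin> bound_vars A \<Longrightarrow> free_for y x A"
  by (induction A) auto

lemma bound_vars_subst: "bound_vars (subst x y A) = bound_vars A"
  by (induction A) auto

lemma free_vars_subst: "free_vars (subst x y A) \<subseteq> insert y (free_vars A - {x})"
  by (induction A) (auto split: if_splits)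

lemma size_subst: "size (subst x y A) = size A"
  by (induction A) auto

lemma subst_inverse:
  "y \<notin> bound_vars A \<Longrightarrow> y \<notin> free_vars A \<Longrightarrow> free_for x y (subst x y A) \<and> subst y x (subst x y A) = A"
proof (induction A)
  case (All z A)
  then show ?case by (auto simp: subst_not_free free_for_not_free)
qed (auto intro!: map_idI)

text \<open>Generalise over the fresh \<open>y\<close>, instantiate \<open>y\<close> back to
  \<open>x\<close>, and generalise over \<open>x\<close>, which is no longer free in
  \<open>All y (subst x y A)\<close>.\<close>

lemma entails_All_fresh:
  assumes "G \<tturnstile> subst x y A" "\<forall>B\<in>G. y \<notin> free_vars B" "y \<notin> bound_vars A" "y \<notin> free_vars A"
  shows "G \<tturnstile> All x A"
proof -
  have "\<turnstile> Imp (All y (subst x y A)) A"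
    using Inst[of x y "subst x y A"] subst_inverse[of y A x] assms by simp
  moreover have "x \<notin> free_vars (All y (subst x y A))"
    using free_vars_subst[of x y A] by (cases "x = y") auto
  ultimately have "\<turnstile> Imp (All y (subst x y A)) (All x A)" using Gen Distr MP by blast
  then show ?thesis by (rule entails_provable_mp) (rule entails_All[OF assms(1,2)])
qed

text \<open>Keeping bound variables odd and free variables even makes all substitutions of the Henkin
  construction capture-free, so that no renaming of bound variables is needed.\<close>

definition separated :: "form \<Rightarrow> bool" where
  "separated A \<longleftrightarrow> (\<forall>v\<in>bound_vars A. odd v) \<and> (\<forall>v\<in>free_vars A. even v)"

lemma separated_simps [simp]:
  "separated (Neg A) \<longleftrightarrow> separated A"
  "separated (Imp A B) \<longleftrightarrow> separated A \<and> separated B"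
  by (auto simp: separated_def)

lemma separated_All:
  assumes "separated (All x A)" "even y"
  shows "separated (subst x y A)" "free_for y x A"
proof -
  show "separated (subst x y A)"
    using assms free_vars_subst[of x y A] by (auto simp: separated_def bound_vars_subst)
  show "free_for y x A"
    using assms by (auto simp: separated_def intro: free_for_not_bound)
qed

text \<open>The Henkin counterexample to a universal formula that has been denied; with existentials
  defined by negation no other case arises.\<close>

fun witness :: "form \<Rightarrow> nat \<Rightarrow> form set" where
  "witness (Neg (All x A)) y = {Neg (subst x y A)}"
| "witness A y = {}"

lemma consistent_witness:
  assumes "consistent (insert A G)" "separated A" "even y" "\<forall>B\<in>insert A G. y \<notin> free_vars B"
  shows "consistent (insert A G \<union> witness A y)"
proof (cases "\<exists>x B. A = Neg (All x B)")
  case True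
  then obtain x B where A: "A = Neg (All x B)" by blast
  show ?thesis
  proof (rule ccontr)
    assume "\<not> ?thesis"
    then have "insert A G \<tturnstile> subst x y B" using A by (intro by_contradiction) simp
    \<comment> \<open>The parity convention at work: \<open>x\<close> and all bound variables of
      \<open>B\<close> are odd, \<open>y\<close> is even.\<close>
    moreover have "y \<notin> bound_vars B" "x \<noteq> y" using assms(2,3) A by (auto simp: separated_def)
    moreover have "y \<notin> free_vars B" using assms(4) A \<open>x \<noteq> y\<close> by auto
    ultimately have "insert A G \<tturnstile> All x B" using entails_All_fresh assms(4) by blast
    moreover have "insert A G \<tturnstile> Neg (All x B)" using A by (auto intro: entails.hyp)
    ultimately show False using assms(1) unfolding consistent_def by blast
  qed
next
  case False
  then have "witness A y = {}" by (cases "(A, y)" rule: witness.cases) auto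
  then show ?thesis using assms by simp
qed

text \<open>Lindenbaum's construction along the coding of formulae. Every stage is finite, so an
  even variable is always left to name a witness, and the language needs no new constants.\<close>

lemma henkin_extension:
  assumes "consistent G" "finite G" "\<forall>A\<in>G. separated A"
  obtains U where "G \<subseteq> U" "consistent U" "\<forall>A\<in>U. separated A"
    "\<And>A. separated A \<Longrightarrow> A \<in> U \<or> Neg A \<in> U"
    "\<And>x A. Neg (All x A) \<in> U \<Longrightarrow> \<exists>y. even y \<and> Neg (subst x y A) \<in> U"
proof -
  define dec where "dec n = inv code n" for n
  have dec: "dec (code A) = A" for A by (simp add: dec_def inj_code)
  define fresh where "fresh G = (SOME y. even y \<and> (\<forall>B\<in>G. y \<notin> free_vars B))" for G :: "form set"
  have fresh: "even (fresh H) \<and> (\<forall>B\<in>H. fresh H \<notin> free_vars B)" if "finite H" for H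
  proof -
    have "finite (\<Union>B\<in>H. free_vars B)" using that finite_free_vars by blast
    then obtain m where "\<forall>v\<in>(\<Union>B\<in>H. free_vars B). v < m"
      using finite_nat_set_iff_bounded by blast
    then have "even (2 * m) \<and> (\<forall>B\<in>H. 2 * m \<notin> free_vars B)" by fastforce
    then show ?thesis unfolding fresh_def by (rule someI)
  qed
  define ext where "ext H A = (if separated A \<and> consistent (insert A H)
    then insert A H \<union> witness A (fresh (insert A H)) else H)" for H A
  define T where "T = rec_nat G (\<lambda>n H. ext H (dec n))"
  have T_Suc: "T (Suc n) = ext (T n) (dec n)" for n by (simp add: T_def)
  have T: "finite (T n) \<and> consistent (T n) \<and> (\<forall>A\<in>T n. separated A)" for n
  proof (induction n)
    case 0
    show ?case using assms by (simp add: T_def)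
  next
    case (Suc n)
    define A where "A = dec n"
    define y where "y = fresh (insert A (T n))"
    show ?case
    proof (cases "separated A \<and> consistent (insert A (T n))")
      case True
      have y: "even y \<and> (\<forall>B\<in>insert A (T n). y \<notin> free_vars B)"
        unfolding y_def using Suc by (intro fresh) simp
      have "consistent (insert A (T n) \<union> witness A y)"
        using True y by (intro consistent_witness) auto
      moreover have "\<forall>B\<in>witness A y. separated B"
        using True y by (cases "(A, y)" rule: witness.cases) (auto intro: separated_All)
      moreover have "finite (witness A y)" by (cases "(A, y)" rule: witness.cases) auto
      moreover have "T (Suc n) = insert A (T n) \<union> witness A y"
        using True by (simp add: T_Suc ext_def A_def y_def)
      ultimately show ?thesis using Suc True by auto
    next
      case False
      then have "T (Suc n) = T n" by (auto simp: T_Suc ext_def A_def)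
      then show ?thesis using Suc by simp
    qed
  qed
  have mono: "T m \<subseteq> T n" if "m \<le> n" for m n
    using that by (induction rule: dec_induct) (auto simp: T_Suc ext_def)
  define U where "U = (\<Union>n. T n)"
  have sub: "\<exists>n. H \<subseteq> T n" if "finite H" "H \<subseteq> U" for H
    using that
  proof (induction)
    case (insert A H)
    then obtain m n where "H \<subseteq> T m" "A \<in> T n" unfolding U_def by blast
    then have "insert A H \<subseteq> T (max m n)" using mono[of m "max m n"] mono[of n "max m n"] by auto
    then show ?case by blast
  qed simp
  have cons: "consistent U"
    unfolding consistent_def
  proof
    assume "\<exists>A. U \<tturnstile> A \<and> U \<tturnstile> Neg A"
    then obtain A H K where "finite H" "H \<subseteq> U" "H \<tturnstile> A" "finite K" "K \<subseteq> U" "K \<tturnstile> Neg A"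
      using entails_finite by metis
    moreover from this obtain n where "H \<union> K \<subseteq> T n" using sub[of "H \<union> K"] by auto
    ultimately have "T n \<tturnstile> A" "T n \<tturnstile> Neg A" using entails_mono by (meson le_sup_iff)+
    then show False using T[of n] unfolding consistent_def by blast
  qed
  \<comment> \<open>A formula consistent with the union is consistent with the stage that considers
    it, so it was added there together with its witness.\<close>
  have step: "consistent (insert A U) \<Longrightarrow> separated A \<Longrightarrow>
      A \<in> U \<and> witness A (fresh (insert A (T (code A)))) \<subseteq> U" for A
  proof -
    assume A: "consistent (insert A U)" "separated A"
    have "insert A (T (code A)) \<subseteq> insert A U" unfolding U_def by blast
    then have "consistent (insert A (T (code A)))"
      using A(1) entails_mono unfolding consistent_def by meson
    then have "T (Suc (code A)) = insert A (T (code A)) \<union> witness A (fresh (insert A (T (code A))))"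
      using A(2) by (simp add: T_Suc ext_def dec)
    then show ?thesis unfolding U_def by blast
  qed
  show ?thesis
  proof
    show "G \<subseteq> U" unfolding U_def using T_def by (metis UN_upper UNIV_I old.nat.simps(6))
    show "consistent U" by (rule cons)
    show "\<forall>A\<in>U. separated A" unfolding U_def using T by blast
    show "A \<in> U \<or> Neg A \<in> U" if "separated A" for A
    proof (rule ccontr)
      assume "\<not> ?thesis"
      then have "\<not> consistent (insert A U)" "\<not> consistent (insert (Neg A) U)"
        using step[of A] step[of "Neg A"] that by auto
      then have "U \<tturnstile> Neg A" "U \<tturnstile> A" using entails_NegI by_contradiction by blast+
      then show False using cons unfolding consistent_def by blast
    qed
    show "\<exists>y. even y \<and> Neg (subst x y A) \<in> U" if N: "Neg (All x A) \<in> U" for x A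
    proof -
      \<comment> \<open>The formula may have entered \<open>U\<close> merely as a witness of another
        one; its own witness comes from the stage numbered by its own code.\<close>
      have "consistent (insert (Neg (All x A)) U)" using cons N by (simp add: insert_absorb)
      moreover have "separated (Neg (All x A))" using N T unfolding U_def by blast
      ultimately have "witness (Neg (All x A)) (fresh (insert (Neg (All x A)) (T (code (Neg (All x A)))))) \<subseteq> U"
        using step by blast
      moreover have "even (fresh (insert (Neg (All x A)) (T (code (Neg (All x A))))))"
        using fresh T by simp
      ultimately show ?thesis by auto
    qed
  qed
qed

text \<open>If \<open>A\<close> is unprovable, \<open>{Neg A}\<close> extends to a Henkin set, and
  the term model of that set, with the naturals as domain, refutes \<open>A\<close>.\<close>

theorem completeness:
  assumes "separated A" and valid: "\<And>(I :: nat \<Rightarrow> nat list \<Rightarrow> bool) s. sem I s A"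
  shows "\<turnstile> A"
proof (rule ccontr)
  assume "\<not> \<turnstile> A"
  then have "consistent {Neg A}" using by_contradiction[of A "{}"] entails_empty by blast
  then obtain U where U: "{Neg A} \<subseteq> U" "consistent U" "\<forall>A\<in>U. separated A"
    "\<And>A. separated A \<Longrightarrow> A \<in> U \<or> Neg A \<in> U"
    "\<And>x A. Neg (All x A) \<in> U \<Longrightarrow> \<exists>y. even y \<and> Neg (subst x y A) \<in> U"
    using henkin_extension[of "{Neg A}"] assms(1) by auto
  have Neg: "Neg B \<in> U \<longleftrightarrow> B \<notin> U" if "separated B" for B
    using U(2,4) that entails.hyp unfolding consistent_def by blast
  have closed: "B \<in> U" if "U \<tturnstile> B" "separated B" for B
    using Neg that U(2) entails.hyp unfolding consistent_def by blast
  \<comment> \<open>The element \<open>d\<close> is the even variable \<open>2 * d\<close>. Halving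
    inverts this on even variables, the only ones free in separated formulae.\<close>
  define I where "I p ds \<longleftrightarrow> Atom p (map ((*) 2) ds) \<in> U" for p ds
  define s :: "nat \<Rightarrow> nat" where "s v = v div 2" for v
  have "separated B \<Longrightarrow> sem I s B \<longleftrightarrow> B \<in> U" for B
  \<comment> \<open>Truth lemma, by size: the instances of \<open>All x B1\<close> are not its
    subformulae, but they are smaller.\<close>
  proof (induction B rule: measure_induct_rule[of size])
    case (less B)
    show ?case
    proof (cases B)
      case (Atom p vs)
      then have "map ((*) 2) (map s vs) = vs"
        using less.prems by (auto simp: separated_def s_def intro: map_idI)
      then show ?thesis unfolding Atom sem.simps I_def by metis
    next
      case B: (Neg B1)
      then show ?thesis using less Neg by simp
    next
      case (Imp B1 B2)
      then have sep: "separated B1" "separated B2" using less.prems by auto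
      have "Imp B1 B2 \<in> U \<longleftrightarrow> (B1 \<in> U \<longrightarrow> B2 \<in> U)"
      proof
        show "B1 \<in> U \<longrightarrow> B2 \<in> U" if "Imp B1 B2 \<in> U"
          using that closed sep by (metis entails.hyp entails.mp)
        assume *: "B1 \<in> U \<longrightarrow> B2 \<in> U"
        have "U \<tturnstile> Imp B1 B2"
        proof (cases "B1 \<in> U")
          case True
          then have "U \<tturnstile> B2" using * by (simp add: entails.hyp)
          then show ?thesis by (rule entails_provable_mp[OF provable.K])
        next
          case False
          then have "insert B1 U \<tturnstile> B1" "insert B1 U \<tturnstile> Neg B1"
            using Neg sep by (auto intro: entails.hyp)
          then show ?thesis by (rule deduction[OF ex_falso])
        qed
        then show "Imp B1 B2 \<in> U" using closed sep by simp
      qed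
      then show ?thesis using less Imp sep by simp
    next
      case (All x B1)
      have sep: "separated (subst x (2 * d) B1)" "free_for (2 * d) x B1" for d
        using less.prems All separated_All[of x B1 "2 * d"] by auto
      have "sem I s (All x B1) \<longleftrightarrow> (\<forall>d. sem I s (subst x (2 * d) B1))"
        using sem_subst[OF sep(2), of I s] by (simp add: s_def)
      also have "\<dots> \<longleftrightarrow> (\<forall>d. subst x (2 * d) B1 \<in> U)"
        using less.IH sep(1) by (simp add: All size_subst)
      also have "\<dots> \<longleftrightarrow> All x B1 \<in> U"
      proof
        show "\<forall>d. subst x (2 * d) B1 \<in> U" if "All x B1 \<in> U"
          using that closed sep entails_provable_mp[OF Inst] entails.hyp by blast
        assume *: "\<forall>d. subst x (2 * d) B1 \<in> U"
        show "All x B1 \<in> U"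
        proof (rule ccontr)
          assume "All x B1 \<notin> U"
          then have "Neg (All x B1) \<in> U" using U(4) less.prems All by blast
          then obtain y where "even y" "Neg (subst x y B1) \<in> U" using U(5) by blast
          then obtain d where "Neg (subst x (2 * d) B1) \<in> U" by (auto elim: evenE)
          then show False using Neg sep * by blast
        qed
      qed
      finally show ?thesis using All by simp
    qed
  qed
  then show False using valid[of I s] U(1) assms(1) Neg by auto
qed


section \<open>Recursive enumerability of provability\<close>

definition code_Neg where "code_Neg a = 4 * a + 1" for a :: nat
definition code_Imp where "code_Imp a b = 4 * prod_encode (a, b) + 2"
definition code_All where "code_All x a = 4 * prod_encode (x, a) + 3"
definition code_Atom where "code_Atom p l = 4 * prod_encode (p, l)"
definition code_Cons where "code_Cons v l = Suc (prod_encode (v, l))"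

definition form_of :: "nat \<Rightarrow> form" where "form_of = inv code"

lemma form_of_code [simp]: "form_of (code A) = A"
  by (simp add: form_of_def inj_code)

lemma code_form_of [simp]: "code (form_of a) = a"
  by (simp add: form_of_def surj_code surj_f_inv_f)

lemma form_of_simps [simp]:
  "form_of (code_Neg a) = Neg (form_of a)"
  "form_of (code_Imp a b) = Imp (form_of a) (form_of b)"
  "form_of (code_All x a) = All x (form_of a)"
  "form_of (code_Atom p l) = Atom p (list_decode l)"
  by (rule injD[OF inj_code]; simp add: code_Neg_def code_Imp_def code_All_def code_Atom_def)+

lemma list_decode_Cons [simp]: "list_decode (code_Cons v l) = v # list_decode l"
  by (simp add: code_Cons_def)

lemma code_eqs:
  "code (Neg A) = code_Neg (code A)"
  "code (Imp A B) = code_Imp (code A) (code B)"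
  "code (All x A) = code_All x (code A)"
  "code (Atom p vs) = code_Atom p (list_encode vs)"
  "list_encode (v # vs) = code_Cons v (list_encode vs)"
  by (simp_all add: code_Neg_def code_Imp_def code_All_def code_Atom_def code_Cons_def)

lemma computable_code_Neg: "computable f \<Longrightarrow> computable (\<lambda>w. code_Neg (f w))"
  unfolding code_Neg_def by (intro computable_intros)

lemma computable_code_binary:
  assumes "computable f" "computable g"
  shows "computable (\<lambda>w. code_Imp (f w) (g w))" "computable (\<lambda>w. code_All (f w) (g w))"
    "computable (\<lambda>w. code_Atom (f w) (g w))" "computable (\<lambda>w. code_Cons (f w) (g w))"
  unfolding code_Imp_def code_All_def code_Atom_def code_Cons_def
  by (intro computable_intros assms)+

lemmas computable_code_intros = computable_code_Neg computable_code_binary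

text \<open>Provability is generated simultaneously with two auxiliary judgements: \<open>list_subst x y\<close>
  relates two lists, and \<open>form_subst x y\<close> relates \<open>A\<close> to \<open>subst x y A\<close> provided that \<open>free_for y x A\<close>.
  That \<open>x\<close> is not free in \<open>A\<close> is expressed by \<open>form_subst x y A A\<close> for some \<open>y \<noteq> x\<close>.\<close>

definition judgement :: "nat \<Rightarrow> nat \<Rightarrow> nat \<Rightarrow> nat \<Rightarrow> nat \<Rightarrow> nat" where
  "judgement t x y a b =
     Suc (prod_encode (t, prod_encode (x, prod_encode (y, prod_encode (a, b)))))"

abbreviation (input) "list_subst \<equiv> judgement 0"
abbreviation (input) "form_subst \<equiv> judgement (Suc 0)"
abbreviation (input) "proves \<equiv> judgement 2 0 0 0"

text \<open>The soundness invariant: every rule of the generated system preserves the intended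
  meaning of the three judgements.\<close>

definition holds :: "nat \<Rightarrow> bool" where
  "holds n \<longleftrightarrow> n = 0 \<or> (\<exists>t x y a b. n = judgement t x y a b \<and>
     (t = 0 \<longrightarrow> list_decode b = map (\<lambda>v. if v = x then y else v) (list_decode a)) \<and>
     (t = Suc 0 \<longrightarrow> free_for y x (form_of a) \<and> form_of b = subst x y (form_of a)) \<and>
     (t = 2 \<longrightarrow> \<turnstile> form_of b))"

lemma holds_simps [simp]:
  "holds 0"
  "holds (list_subst x y a b) \<longleftrightarrow>
     list_decode b = map (\<lambda>v. if v = x then y else v) (list_decode a)"
  "holds (form_subst x y a b) \<longleftrightarrow> free_for y x (form_of a) \<and> form_of b = subst x y (form_of a)"
  "holds (proves a) \<longleftrightarrow> \<turnstile> form_of a"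
  by (auto simp: holds_def judgement_def)

definition param :: "nat \<Rightarrow> nat \<Rightarrow> nat \<Rightarrow> nat \<Rightarrow> nat \<Rightarrow> nat \<Rightarrow> nat" where
  "param x y a b c d = prod_encode (x, prod_encode (y, prod_encode (a, prod_encode (b,
     prod_encode (c, d)))))"

abbreviation (input) "w_x w \<equiv> pi1 w"
abbreviation (input) "w_y w \<equiv> pi1 (pi2 w)"
abbreviation (input) "w_a w \<equiv> pi1 (pi2 (pi2 w))"
abbreviation (input) "w_b w \<equiv> pi1 (pi2 (pi2 (pi2 w)))"
abbreviation (input) "w_c w \<equiv> pi1 (pi2 (pi2 (pi2 (pi2 w))))"
abbreviation (input) "w_d w \<equiv> pi2 (pi2 (pi2 (pi2 (pi2 w))))"

text \<open>The order matters, since derivations below select rules by position. The three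
  quantifier rules for substitution follow \<open>free_for\<close>: \<open>x\<close> is bound here,
  \<open>x\<close> is not free in the body, or no capture occurs. The second one tests with its own
  variable \<open>w_c w\<close>, because \<open>w_y w\<close> may equal \<open>x\<close> or be
  captured.\<close>

definition calculus :: "((nat \<Rightarrow> nat) \<times> (nat \<Rightarrow> nat) \<times> (nat \<Rightarrow> nat)) list" where
  "calculus =
   [(\<lambda>w. 0, \<lambda>w. 0, \<lambda>w. list_subst (w_x w) (w_y w) 0 0),
    (\<lambda>w. list_subst (w_x w) (w_y w) (w_a w) (w_b w), \<lambda>w. 0,
     \<lambda>w. list_subst (w_x w) (w_y w) (code_Cons (w_c w) (w_a w))
       (code_Cons (if w_c w = w_x w then w_y w else w_c w) (w_b w))),
    (\<lambda>w. list_subst (w_x w) (w_y w) (w_a w) (w_b w), \<lambda>w. 0,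
     \<lambda>w. form_subst (w_x w) (w_y w) (code_Atom (w_c w) (w_a w)) (code_Atom (w_c w) (w_b w))),
    (\<lambda>w. form_subst (w_x w) (w_y w) (w_a w) (w_b w), \<lambda>w. 0,
     \<lambda>w. form_subst (w_x w) (w_y w) (code_Neg (w_a w)) (code_Neg (w_b w))),
    (\<lambda>w. form_subst (w_x w) (w_y w) (w_a w) (w_b w),
     \<lambda>w. form_subst (w_x w) (w_y w) (w_c w) (w_d w),
     \<lambda>w. form_subst (w_x w) (w_y w) (code_Imp (w_a w) (w_c w)) (code_Imp (w_b w) (w_d w))),
    (\<lambda>w. 0, \<lambda>w. 0,
     \<lambda>w. form_subst (w_x w) (w_y w) (code_All (w_x w) (w_a w)) (code_All (w_x w) (w_a w))),
    (\<lambda>w. form_subst (w_x w) (w_c w) (w_a w) (w_a w), \<lambda>w. 0,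
     \<lambda>w. if w_c w = w_x w then 0 else
       form_subst (w_x w) (w_y w) (code_All (w_b w) (w_a w)) (code_All (w_b w) (w_a w))),
    (\<lambda>w. form_subst (w_x w) (w_y w) (w_a w) (w_b w), \<lambda>w. 0,
     \<lambda>w. if w_c w = w_x w then 0 else if w_c w = w_y w then 0 else
       form_subst (w_x w) (w_y w) (code_All (w_c w) (w_a w)) (code_All (w_c w) (w_b w))),
    (\<lambda>w. 0, \<lambda>w. 0, \<lambda>w. proves (code_Imp (w_a w) (code_Imp (w_b w) (w_a w)))),
    (\<lambda>w. 0, \<lambda>w. 0, \<lambda>w. proves (code_Imp (code_Imp (w_a w) (code_Imp (w_b w) (w_c w)))
       (code_Imp (code_Imp (w_a w) (w_b w)) (code_Imp (w_a w) (w_c w))))),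
    (\<lambda>w. 0, \<lambda>w. 0, \<lambda>w. proves (code_Imp (code_Imp (code_Neg (w_b w)) (code_Neg (w_a w)))
       (code_Imp (code_Imp (code_Neg (w_b w)) (w_a w)) (w_b w)))),
    (\<lambda>w. form_subst (w_x w) (w_y w) (w_a w) (w_b w), \<lambda>w. 0,
     \<lambda>w. proves (code_Imp (code_All (w_x w) (w_a w)) (w_b w))),
    (\<lambda>w. form_subst (w_x w) (w_y w) (w_a w) (w_a w), \<lambda>w. 0,
     \<lambda>w. if w_y w = w_x w then 0 else proves (code_Imp (code_All (w_x w) (code_Imp (w_a w) (w_b w)))
       (code_Imp (w_a w) (code_All (w_x w) (w_b w))))),
    (\<lambda>w. proves (code_Imp (w_a w) (w_b w)), \<lambda>w. proves (w_a w), \<lambda>w. proves (w_b w)),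
    (\<lambda>w. proves (w_a w), \<lambda>w. 0, \<lambda>w. proves (code_All (w_x w) (w_a w)))]"

definition derives :: "nat \<Rightarrow> bool" where "derives = derivable calculus"

lemma computable_calculus: "\<forall>(P, Q, C)\<in>set calculus. computable P \<and> computable Q \<and> computable C"
  unfolding calculus_def judgement_def
  by (simp only: list.set ball_simps prod.case simp_thms)
    (intro conjI computable_intros computable_code_intros)

lemma subst_id_iff: "y \<noteq> x \<Longrightarrow> A = subst x y A \<longleftrightarrow> x \<notin> free_vars A"
  using free_vars_subst[of x y A] by (auto simp: subst_not_free)

lemma derives_holds: "derives n \<Longrightarrow> holds n"
  unfolding derives_def
proof (induction rule: derivable.induct)
  case (derivable_rule P Q C w)
  show ?case
    using derivable_rule.hyps(1) derivable_rule.IH unfolding calculus_def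
    by (auto simp: subst_not_free free_for_not_free subst_id_iff
        provable.K provable.S Contra Inst Distr Gen dest: MP)
qed simp

lemma derives_0: "derives 0"
  by (simp add: derives_def derivable_0)

lemma derives_nth:
  "k < length calculus \<Longrightarrow> derives (fst (calculus ! k) w) \<Longrightarrow> derives (fst (snd (calculus ! k)) w) \<Longrightarrow>
   derives (snd (snd (calculus ! k)) w)"
  using derivable_rule[of "fst (calculus ! k)" "fst (snd (calculus ! k))" "snd (snd (calculus ! k))"]
  by (simp add: derives_def)

lemma derives_list_subst:
  "derives (list_subst x y (list_encode vs)
     (list_encode (map (\<lambda>v. if v = x then y else v) vs)))"
proof (induction vs)
  case Nil
  show ?case using derives_nth[of 0 "param x y 0 0 0 0"]
    by (simp add: calculus_def param_def derives_0)
next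
  case (Cons v vs)
  then show ?case
    using derives_nth[of 1 "param x y (list_encode vs)
        (list_encode (map (\<lambda>v. if v = x then y else v) vs)) v 0"]
    by (simp add: calculus_def param_def derives_0 code_eqs del: list_encode.simps
        cong: if_cong)
qed

lemma derives_form_subst:
  "free_for y x A \<Longrightarrow> derives (form_subst x y (code A) (code (subst x y A)))"
proof (induction A arbitrary: y)
  case (Atom p vs)
  show ?case
    using derives_nth[of 2 "param x y (list_encode vs)
        (list_encode (map (\<lambda>v. if v = x then y else v) vs)) p 0"] derives_list_subst[of x y vs]
    by (simp add: calculus_def param_def derives_0 code_eqs del: list_encode.simps code.simps)
next
  case (Neg A)
  then show ?case
    using derives_nth[of 3 "param x y (code A) (code (subst x y A)) 0 0"]
    by (simp add: calculus_def param_def derives_0 code_eqs del: code.simps)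
next
  case (Imp A B)
  then show ?case
    using derives_nth[of 4 "param x y (code A) (code (subst x y A)) (code B)
        (code (subst x y B))"]
    by (simp add: calculus_def param_def code_eqs del: code.simps)
next
  case (All z A)
  consider "z = x" | "z \<noteq> x" "x \<notin> free_vars A" | "z \<noteq> x" "z \<noteq> y" "free_for y x A"
    using All.prems by auto
  then show ?case
  proof cases
    case 1
    then show ?thesis using derives_nth[of 5 "param x y (code A) 0 0 0"]
      by (simp add: calculus_def param_def derives_0 code_eqs del: code.simps)
  next
    case 2
    \<comment> \<open>\<open>Suc x\<close> is merely some variable other than \<open>x\<close>; the
      induction hypothesis covers it because the target variable was generalised.\<close>
    then have "derives (form_subst x (Suc x) (code A) (code A))"
      using All.IH[of "Suc x"] by (simp add: subst_not_free free_for_not_free)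
    then show ?thesis
      using 2 derives_nth[of 6 "param x y (code A) z (Suc x) 0"]
      by (simp add: calculus_def param_def derives_0 code_eqs subst_not_free del: code.simps)
  next
    case 3
    then show ?thesis
      using All.IH[of y] derives_nth[of 7 "param x y (code A) (code (subst x y A)) z 0"]
      by (simp add: calculus_def param_def derives_0 code_eqs del: code.simps)
  qed
qed

lemma derives_proves: "\<turnstile> A \<Longrightarrow> derives (proves (code A))"
proof (induction rule: provable.induct)
  case (K A B)
  show ?case using derives_nth[of 8 "param 0 0 (code A) (code B) 0 0"]
    by (simp add: calculus_def param_def derives_0 code_eqs del: code.simps)
next
  case (S A B C)
  show ?case using derives_nth[of 9 "param 0 0 (code A) (code B) (code C) 0"]
    by (simp add: calculus_def param_def derives_0 code_eqs del: code.simps)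
next
  case (Contra B A)
  show ?case using derives_nth[of 10 "param 0 0 (code A) (code B) 0 0"]
    by (simp add: calculus_def param_def derives_0 code_eqs del: code.simps)
next
  case (Inst y x A)
  then show ?case
    using derives_nth[of 11 "param x y (code A) (code (subst x y A)) 0 0"]
      derives_form_subst[of y x A]
    by (simp add: calculus_def param_def derives_0 code_eqs del: code.simps)
next
  case (Distr x A B)
  then have "derives (form_subst x (Suc x) (code A) (code A))"
    using derives_form_subst[of "Suc x" x A] by (simp add: subst_not_free free_for_not_free)
  then show ?case using derives_nth[of 12 "param x (Suc x) (code A) (code B) 0 0"]
    by (simp add: calculus_def param_def derives_0 code_eqs del: code.simps)
next
  case (MP A B)
  then show ?case using derives_nth[of 13 "param 0 0 (code A) (code B) 0 0"]
    by (simp add: calculus_def param_def derives_0 code_eqs del: code.simps)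
next
  case (Gen A x)
  then show ?case using derives_nth[of 14 "param x 0 (code A) 0 0 0"]
    by (simp add: calculus_def param_def derives_0 code_eqs del: code.simps)
qed

theorem sigma01_preorder_logical_implication: "sigma01_preorder logical_implication"
proof -
  have iff: "(a, b) \<in> logical_implication \<longleftrightarrow> \<turnstile> Imp (form_of a) (form_of b)" for a b
  proof
    assume "\<turnstile> Imp (form_of a) (form_of b)"
    then have "(code (form_of a), code (form_of b)) \<in> logical_implication"
      unfolding logical_implication_def by blast
    then show "(a, b) \<in> logical_implication" by simp
  qed (auto simp: logical_implication_def)
  have "refl logical_implication" by (simp add: refl_on_def iff provable_refl)
  moreover have "trans logical_implication"
  proof (rule transI)
    show "(a, c) \<in> logical_implication"
      if "(a, b) \<in> logical_implication" "(b, c) \<in> logical_implication" for a b c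
      using that unfolding iff by (rule provable_trans)
  qed
  ultimately have "preorder_on UNIV logical_implication" by (simp add: preorder_on_def)
  moreover have "re_rel logical_implication"
  proof -
    obtain e where e: "computable e" "\<And>n. derives n \<longleftrightarrow> (\<exists>k. e k = n)"
      using derivable_enumerable[OF computable_calculus] unfolding derives_def by blast
    let ?f = "\<lambda>z. proves (code_Imp (pi1 z) (pi2 z))"
    have "computable ?f" unfolding judgement_def
      by (intro computable_intros computable_code_intros)
    then have "re_rel {(x, y). \<exists>k. e k = ?f (prod_encode (x, y))}"
      using e(1) by (intro re_rel_enumerable)
    moreover have "\<turnstile> Imp (form_of x) (form_of y) \<longleftrightarrow> derives (?f (prod_encode (x, y)))"
      for x y
      using derives_holds[of "?f (prod_encode (x, y))"]
        derives_proves[of "Imp (form_of x) (form_of y)"]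
      by (auto simp: code_eqs simp del: code.simps)
    then have "{(x, y). \<exists>k. e k = ?f (prod_encode (x, y))} = logical_implication"
      using e(2) iff by auto
    ultimately show ?thesis by simp
  qed
  ultimately show ?thesis by (simp add: sigma01_preorder_def)
qed


section \<open>Axiomatising the evaluation of a program\<close>

definition And :: "form \<Rightarrow> form \<Rightarrow> form" where
  "And A B = Neg (Imp A (Neg B))"

definition Exists :: "nat \<Rightarrow> form \<Rightarrow> form" where
  "Exists x A = Neg (All x (Neg A))"

lemma sem_And [simp]: "sem I s (And A B) \<longleftrightarrow> sem I s A \<and> sem I s B"
  by (simp add: And_def)

lemma sem_Exists [simp]: "sem I s (Exists x A) \<longleftrightarrow> (\<exists>d. sem I (s(x := d)) A)"
  by (simp add: Exists_def)

lemma sem_foldr_And [simp]: "sem I s (foldr And As B) \<longleftrightarrow> (\<forall>A\<in>set As. sem I s A) \<and> sem I s B"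
  by (induction As) auto

lemma sem_foldr_Imp [simp]: "sem I s (foldr Imp As B) \<longleftrightarrow> ((\<forall>A\<in>set As. sem I s A) \<longrightarrow> sem I s B)"
  by (induction As) auto

definition closure :: "form \<Rightarrow> form" where
  "closure A = foldr All (sorted_list_of_set (free_vars A)) A"

lemma sem_closure: "sem I s (closure A) \<longleftrightarrow> (\<forall>t. sem I t A)"
proof -
  have *: "sem I s (foldr All vs A) \<longleftrightarrow> (\<forall>t. (\<forall>v. v \<notin> set vs \<longrightarrow> t v = s v) \<longrightarrow> sem I t A)" for vs s
  proof (induction vs arbitrary: s)
    case Nil
    have "(\<forall>v. t v = s v) \<longleftrightarrow> t = s" for t by auto
    then show ?case by simp
  next
    case (Cons x vs)
    have "(\<exists>d. \<forall>v. v \<notin> set vs \<longrightarrow> t v = (s(x := d)) v) \<longleftrightarrow> (\<forall>v. v \<notin> set (x # vs) \<longrightarrow> t v = s v)" for t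
      by (auto intro!: exI[of _ "t x"])
    then show ?case unfolding foldr.simps o_apply sem.simps Cons.IH by blast
  qed
  show ?thesis
  proof
    assume L: "sem I s (closure A)"
    show "\<forall>t. sem I t A"
    proof
      fix t
      define u where "u v = (if v \<in> free_vars A then t v else s v)" for v
      have "sem I u A" using L unfolding closure_def * by (simp add: u_def finite_free_vars)
      then show "sem I t A" using sem_cong[of A t u] by (simp add: u_def)
    qed
  qed (simp add: closure_def *)
qed

lemma free_vars_closure: "free_vars (closure A) = {}"
proof -
  have "free_vars (foldr All vs A) = free_vars A - set vs" for vs by (induction vs) auto
  then show ?thesis by (simp add: closure_def finite_free_vars)
qed

lemma bound_vars_closure: "bound_vars (closure A) = free_vars A \<union> bound_vars A"
proof -
  have "bound_vars (foldr All vs A) = set vs \<union> bound_vars A" for vs by (induction vs) auto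
  then show ?thesis by (simp add: closure_def finite_free_vars)
qed

instance recf :: countable by countable_datatype

abbreviation (input) "zero_sym \<equiv> 0 :: nat"
abbreviation (input) "succ_sym \<equiv> Suc 0"
abbreviation (input) "upper_sym \<equiv> 2 :: nat"

text \<open>The offsets avoid the symbols 0, 1, 2, and parity separates the two families.
  \<open>to_nat\<close> may be arbitrary: for a fixed program the clauses enter the reduction as
  constants.\<close>

definition graph_sym :: "recf \<Rightarrow> nat" where "graph_sym q = 2 * to_nat q + 3"
definition search_sym :: "recf \<Rightarrow> nat" where "search_sym q = 2 * to_nat q + 4"

definition var :: "nat \<Rightarrow> nat" where "var i = 2 * i + 1"
definition vars :: "nat \<Rightarrow> nat \<Rightarrow> nat list" where "vars i j = map var [i..<j]"

text \<open>\<open>graph_sym q\<close> stands for the graph of \<open>q\<close>, with the value as last argument, and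
  \<open>search_sym p\<close>, applied to \<open>n\<close> and \<open>xs\<close>, says that \<open>p\<close> has positive values at all \<open>i # xs\<close>
  with \<open>i < n\<close>. The clauses for \<open>q\<close> are generated only for the number \<open>k\<close> of
  arguments with which it is called.\<close>

fun clauses :: "recf \<Rightarrow> nat \<Rightarrow> form list" where
  "clauses Zero k =
     [Imp (Atom zero_sym [var k]) (Atom (graph_sym Zero) (vars 0 k @ [var k]))]"
| "clauses Succ k =
     [Imp (Atom succ_sym [var 0, var 1]) (Atom (graph_sym Succ) [var 0, var 1])]"
| "clauses (Proj i) k =
     (if i < k then [Atom (graph_sym (Proj i)) (vars 0 k @ [var i])] else [])"
| "clauses (Comp p qs) k = (let m = length qs in
     foldr Imp (map (\<lambda>i. Atom (graph_sym (qs ! i)) (vars 0 k @ [var (k + i)])) [0..<m])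
       (Imp (Atom (graph_sym p) (vars k (k + m) @ [var (k + m)]))
         (Atom (graph_sym (Comp p qs)) (vars 0 k @ [var (k + m)])))
     # clauses p m @ concat (map (\<lambda>q. clauses q k) qs))"
| "clauses (PrimRec p q) k = (let m = k - 1; r = graph_sym (PrimRec p q); xs = vars 0 m;
       n = var m; y = var (m + 1); z = var (m + 2); n' = var (m + 3) in
     [Imp (Atom zero_sym [n]) (Imp (Atom (graph_sym p) (xs @ [z])) (Atom r (n # xs @ [z]))),
      Imp (Atom succ_sym [n, n']) (Imp (Atom r (n # xs @ [y]))
        (Imp (Atom (graph_sym q) (y # n # xs @ [z])) (Atom r (n' # xs @ [z]))))]
     @ clauses p m @ clauses q (m + 2))"
| "clauses (Mu p) k = (let xs = vars 0 k; n = var k; n' = var (k + 1); w = var (k + 2);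
       v = var (k + 3) in
     [Imp (Atom zero_sym [n]) (Atom (search_sym p) (n # xs)),
      Imp (Atom succ_sym [n, n']) (Imp (Atom (search_sym p) (n # xs))
        (Imp (Atom (graph_sym p) (n # xs @ [w])) (Imp (Atom succ_sym [v, w])
          (Atom (search_sym p) (n' # xs))))),
      Imp (Atom (search_sym p) (n # xs)) (Imp (Atom zero_sym [w])
        (Imp (Atom (graph_sym p) (n # xs @ [w])) (Atom (graph_sym (Mu p)) (xs @ [n]))))]
     @ clauses p (Suc k))"

definition std :: "(nat \<Rightarrow> bool) \<Rightarrow> nat \<Rightarrow> nat list \<Rightarrow> bool" where
  "std U s ds \<longleftrightarrow>
     (s = zero_sym \<longrightarrow> ds = [0]) \<and> (s = succ_sym \<longrightarrow> (\<exists>n. ds = [n, Suc n])) \<and>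
     (s = upper_sym \<longrightarrow> (\<exists>z. ds = [z] \<and> U z)) \<and>
     (\<forall>q. s = graph_sym q \<longrightarrow> (\<exists>xs y. ds = xs @ [y] \<and> ev q xs y)) \<and>
     (\<forall>q. s = search_sym q \<longrightarrow> (\<exists>n xs. ds = n # xs \<and> (\<forall>i<n. \<exists>v. ev q (i # xs) (Suc v))))"

lemma sym_distinct:
  "graph_sym q \<noteq> zero_sym" "graph_sym q \<noteq> succ_sym" "graph_sym q \<noteq> upper_sym"
  "search_sym q \<noteq> zero_sym" "search_sym q \<noteq> succ_sym" "search_sym q \<noteq> upper_sym"
  "graph_sym q \<noteq> search_sym q'"
  unfolding graph_sym_def search_sym_def by presburger+

lemma sym_inject: "graph_sym q = graph_sym q' \<longleftrightarrow> q = q'" "search_sym q = search_sym q' \<longleftrightarrow> q = q'"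
  by (simp_all add: graph_sym_def search_sym_def)

text \<open>The variants with leading \<open>x\<close> and \<open>x'\<close> match the normal form
  into which the simplifier brings an append to a nonempty list.\<close>

lemma std_simps:
  "std U zero_sym ds \<longleftrightarrow> ds = [0]"
  "std U succ_sym ds \<longleftrightarrow> (\<exists>n. ds = [n, Suc n])"
  "std U upper_sym ds \<longleftrightarrow> (\<exists>z. ds = [z] \<and> U z)"
  "std U (graph_sym q) (xs @ [y]) \<longleftrightarrow> ev q xs y"
  "std U (graph_sym q) (x # xs @ [y]) \<longleftrightarrow> ev q (x # xs) y"
  "std U (graph_sym q) (x # x' # xs @ [y]) \<longleftrightarrow> ev q (x # x' # xs) y"
  "std U (search_sym q) (n # xs) \<longleftrightarrow> (\<forall>i<n. \<exists>v. ev q (i # xs) (Suc v))"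
proof -
  note s = sym_distinct sym_distinct[symmetric] sym_inject
  show g: "std U (graph_sym q) (xs @ [y]) \<longleftrightarrow> ev q xs y" for xs by (auto simp: std_def s)
  show "std U (graph_sym q) (x # xs @ [y]) \<longleftrightarrow> ev q (x # xs) y" using g[of "x # xs"] by simp
  show "std U (graph_sym q) (x # x' # xs @ [y]) \<longleftrightarrow> ev q (x # x' # xs) y"
    using g[of "x # x' # xs"] by simp
qed (auto simp: std_def sym_distinct sym_distinct[symmetric] sym_inject)

text \<open>Read in the standard structure, a graph clause is an introduction rule of
  \<open>ev\<close>; the search clauses start a bounded quantifier and extend it by one.\<close>

lemma std_clauses: "A \<in> set (clauses q k) \<Longrightarrow> sem (std U) t A"
proof (induction q arbitrary: k A)
  case Zero
  then show ?case by (auto simp: std_simps intro: ev_Zero)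
next
  case Succ
  have "[t (var 0), t (var 1)] = [t (var 0)] @ [t (var 1)]" by simp
  then have "std U (graph_sym Succ) [t (var 0), t (var 1)] \<longleftrightarrow> ev Succ [t (var 0)] (t (var 1))"
    using std_simps(4)[of U Succ "[t (var 0)]"] by simp
  with Succ show ?case by (auto simp: std_simps intro: ev_Succ)
next
  case (Proj i)
  then show ?case
    using ev_Proj[of i "map t (vars 0 k)"] by (auto simp: std_simps vars_def split: if_splits)
next
  case (Comp p qs)
  let ?m = "length qs"
  let ?C = "foldr Imp (map (\<lambda>i. Atom (graph_sym (qs ! i)) (vars 0 k @ [var (k + i)])) [0..<?m])
       (Imp (Atom (graph_sym p) (vars k (k + ?m) @ [var (k + ?m)]))
         (Atom (graph_sym (Comp p qs)) (vars 0 k @ [var (k + ?m)])))"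
  consider "A = ?C" | "A \<in> set (clauses p ?m)" | q where "q \<in> set qs" "A \<in> set (clauses q k)"
    using Comp.prems by (auto simp: Let_def)
  then show ?case
  proof cases
    case 1
    have "ev (Comp p qs) xs z"
      if "\<forall>i<?m. ev (qs ! i) xs (t (var (k + i)))" "ev p (map t (vars k (k + ?m))) z" for xs z
      using that
      by (intro ev_Comp[of xs qs "map t (vars k (k + ?m))"])
        (auto simp: list_all2_conv_all_nth vars_def)
    then show ?thesis unfolding 1 by (auto simp: std_simps)
  qed (use Comp.IH in auto)
next
  case (PrimRec p q)
  then show ?case
    by (auto simp: Let_def std_simps intro: ev_PrimRec_0 ev_PrimRec_Suc)
next
  case (Mu p)
  then show ?case
    by (auto simp: Let_def std_simps less_Suc_eq intro: ev_Mu) blast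
qed

section \<open>Representatives of numbers in an arbitrary structure\<close>

fun rep :: "(nat \<Rightarrow> 'd list \<Rightarrow> bool) \<Rightarrow> nat \<Rightarrow> 'd \<Rightarrow> bool" where
  "rep I 0 d \<longleftrightarrow> I zero_sym [d]"
| "rep I (Suc n) d \<longleftrightarrow> (\<exists>c. rep I n c \<and> I succ_sym [c, d])"

lemma rep_std: "rep (std U) n d \<longleftrightarrow> d = n"
  by (induction n arbitrary: d) (auto simp: std_simps)

lemma rep_total:
  assumes "\<exists>d. I zero_sym [d]" "\<forall>c. \<exists>d. I succ_sym [c, d]"
  shows "\<exists>d. rep I n d"
proof (induction n)
  case 0
  show ?case using assms(1) by simp
next
  case (Suc n)
  then obtain c d where "rep I n c" "I succ_sym [c, d]" using assms(2) by blast
  then show ?case by (intro exI[of _ d]) auto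
qed

text \<open>Division by 2 undoes \<open>var\<close>, so a list of elements instantiates the
  variables of a clause in order.\<close>

definition val :: "'d list \<Rightarrow> nat \<Rightarrow> 'd" where
  "val es v = es ! (v div 2)"

lemma val_var: "val es (var i) = es ! i"
  by (simp add: val_def var_def)

lemma map_val_vars: "j \<le> length es \<Longrightarrow> map (val es) (vars i j) = take (j - i) (drop i es)"
  by (rule nth_equalityI) (auto simp: vars_def val_var)

text \<open>Zero and successors need not be unique in the structure, and nothing identifies two
  representatives of the same number; hence the value is only claimed for some representative.\<close>

lemma rep_graph:
  assumes "ev q xs y" "\<And>A t. A \<in> set (clauses q (length xs)) \<Longrightarrow> sem I t A"
    "list_all2 (rep I) xs ds" "\<exists>d. I zero_sym [d]" "\<forall>c. \<exists>d. I succ_sym [c, d]"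
  shows "\<exists>e. rep I y e \<and> I (graph_sym q) (ds @ [e])"
  using assms(1-3)
proof (induction arbitrary: ds rule: ev.induct)
  case (ev_Zero xs)
  then have len: "length ds = length xs" by (simp add: list_all2_lengthD)
  obtain e where "I zero_sym [e]" using assms(4) by blast
  moreover from this have "I (graph_sym Zero) (ds @ [e])"
    using ev_Zero.prems(1)[OF nth_mem[of 0], of "val (ds @ [e])"] len
    by (auto simp: map_val_vars val_var nth_append)
  ultimately show ?case by auto
next
  case (ev_Succ x)
  then obtain d where d: "ds = [d]" "rep I x d" by (auto simp: list_all2_Cons1)
  obtain e where e: "I succ_sym [d, e]" using assms(5) by blast
  then have "I (graph_sym Succ) [d, e]"
    using ev_Succ.prems(1)[OF nth_mem[of 0], of "val [d, e]"] by (auto simp: val_var)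
  then show ?case using d e by auto
next
  case (ev_Proj i xs)
  then have len: "length ds = length xs" by (simp add: list_all2_lengthD)
  have "I (graph_sym (Proj i)) (ds @ [ds ! i])"
    using ev_Proj.prems(1)[OF nth_mem[of 0], of "val ds"] ev_Proj.hyps len
    by (auto simp: map_val_vars val_var nth_append)
  moreover have "rep I (xs ! i) (ds ! i)"
    using ev_Proj by (simp add: list_all2_conv_all_nth)
  ultimately show ?case by blast
next
  case (ev_Comp xs qs ys p z)
  have len: "length ds = length xs" "length ys = length qs"
    using ev_Comp.prems(2) ev_Comp.IH(1) by (simp_all add: list_all2_lengthD)
  have "\<exists>e. rep I (ys ! i) e \<and> I (graph_sym (qs ! i)) (ds @ [e])" if "i < length qs" for i
  proof -
    have "sem I t A" if "A \<in> set (clauses (qs ! i) (length xs))" for A t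
      using ev_Comp.prems(1)[of A t] that nth_mem[OF \<open>i < length qs\<close>] by (auto simp: Let_def)
    then show ?thesis
      using list_all2_nthD[OF ev_Comp.IH(1) that] ev_Comp.prems(2) by blast
  qed
  then obtain f where
    f: "\<And>i. i < length qs \<Longrightarrow> rep I (ys ! i) (f i) \<and> I (graph_sym (qs ! i)) (ds @ [f i])"
    by metis
  define es where "es = map f [0..<length qs]"
  have "list_all2 (rep I) ys es" using f len by (simp add: list_all2_conv_all_nth es_def)
  moreover have "sem I t A" if "A \<in> set (clauses p (length ys))" for A t
    using ev_Comp.prems(1)[of A t] that len by (auto simp: Let_def)
  ultimately obtain e where e: "rep I z e" "I (graph_sym p) (es @ [e])" using ev_Comp.IH(2) by blast
  have [simp]: "length es = length qs" by (simp add: es_def)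
  let ?v = "val (ds @ es @ [e])"
  have v: "map ?v (vars 0 (length xs)) = ds"
    "map ?v (vars (length xs) (length xs + length qs)) = es"
    "?v (var (length xs + length qs)) = e"
    using len by (simp_all add: map_val_vars val_var nth_append)
  have "?v (var (length xs + i)) = f i" if "i < length qs" for i
    using len that by (simp add: val_var nth_append es_def)
  moreover have "sem I ?v (hd (clauses (Comp p qs) (length xs)))"
    by (rule ev_Comp.prems(1)) (simp add: Let_def)
  ultimately have "I (graph_sym (Comp p qs)) (ds @ [e])"
    using f e(2) v by (auto simp: Let_def)
  then show ?case using e(1) by blast
next
  case (ev_PrimRec_0 p xs z q)
  then obtain n ds' where ds: "ds = n # ds'" "I zero_sym [n]" "list_all2 (rep I) xs ds'"
    by (auto simp: list_all2_Cons1)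
  then have len: "length ds' = length xs" by (simp add: list_all2_lengthD)
  have "sem I t A" if "A \<in> set (clauses p (length xs))" for A t
    using ev_PrimRec_0.prems(1)[of A t] that by (auto simp: Let_def)
  then obtain e where e: "rep I z e" "I (graph_sym p) (ds' @ [e])"
    using ev_PrimRec_0.IH ds(3) by blast
  \<comment> \<open>After the parameters, the slots are those of \<open>n\<close>, \<open>y\<close>,
    \<open>z\<close>, \<open>n'\<close> in the clause; the base clause mentions only
    \<open>n\<close> and \<open>z\<close>, so the other two are fillers.\<close>
  have "I (graph_sym (PrimRec p q)) (n # ds' @ [e])"
    using ev_PrimRec_0.prems(1)[OF nth_mem[of 0], of "val (ds' @ [n, n, e, n])"] e(2) ds(2) len
    by (auto simp: Let_def map_val_vars val_var nth_append)
  then show ?case using e(1) ds(1) by auto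
next
  case (ev_PrimRec_Suc p q n xs y z)
  then obtain n' c ds' where ds: "ds = n' # ds'" "rep I n c" "I succ_sym [c, n']"
    "list_all2 (rep I) xs ds'"
    by (auto simp: list_all2_Cons1)
  then have len: "length ds' = length xs" by (simp add: list_all2_lengthD)
  have cl: "sem I t A" if "A \<in> set (clauses (PrimRec p q) (Suc (length xs)))" for A t
    using ev_PrimRec_Suc.prems(1)[of A t] that by simp
  then obtain d where d: "rep I y d" "I (graph_sym (PrimRec p q)) (c # ds' @ [d])"
    using ev_PrimRec_Suc.IH(1)[of "c # ds'"] ds by auto
  have "sem I t A" if "A \<in> set (clauses q (Suc (Suc (length xs))))" for A t
    using cl[of A t] that by (auto simp: Let_def)
  then obtain e where e: "rep I z e" "I (graph_sym q) (d # c # ds' @ [e])"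
    using ev_PrimRec_Suc.IH(2)[of "d # c # ds'"] ds d by auto
  have "I (graph_sym (PrimRec p q)) (n' # ds' @ [e])"
    using cl[OF nth_mem[of 1], of "val (ds' @ [c, d, e, n'])"] e(2) d(2) ds(3) len
    by (auto simp: Let_def map_val_vars val_var nth_append)
  then show ?case using e(1) ds(1) by auto
next
  case (ev_Mu p n xs)
  have len: "length ds = length xs" using ev_Mu.prems by (simp add: list_all2_lengthD)
  have cl: "sem I t A" if "A \<in> set (clauses p (Suc (length xs)))" for A t
    using ev_Mu.prems(1)[of A t] that by (auto simp: Let_def)
  \<comment> \<open>Walks up the successors to every representative of \<open>m\<close>. Each step
    needs a value known to be positive: a representative of \<open>Suc v\<close> comes with a
    predecessor, as the clause requires.\<close>
  have search: "I (search_sym p) (c # ds)" if "rep I m c" "m \<le> n" for m c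
    using that
  proof (induction m arbitrary: c)
    case 0
    then show ?case
      using ev_Mu.prems(1)[OF nth_mem[of 0], of "val (ds @ [c, c, c, c])"] len
      by (auto simp: Let_def map_val_vars val_var nth_append)
  next
    case (Suc m)
    then obtain b where b: "rep I m b" "I succ_sym [b, c]" by auto
    obtain v where v: "\<And>ds'. list_all2 (rep I) (m # xs) ds' \<Longrightarrow>
        \<exists>e. rep I (Suc v) e \<and> I (graph_sym p) (ds' @ [e])"
      using ev_Mu.IH(2) Suc.prems(2) cl by (metis Suc_le_lessD length_Cons)
    obtain w u where "rep I v u" "I succ_sym [u, w]" "I (graph_sym p) (b # ds @ [w])"
      using v[of "b # ds"] b(1) ev_Mu.prems(2) by auto
    moreover have "I (search_sym p) (b # ds)" using Suc b by simp
    ultimately show ?case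
      using ev_Mu.prems(1)[OF nth_mem[of 1], of "val (ds @ [b, c, w, u])"] b(2) len
      by (auto simp: Let_def map_val_vars val_var nth_append)
  qed
  obtain c where c: "rep I n c" using rep_total[of I n] assms(4,5) by blast
  obtain w where "I zero_sym [w]" "I (graph_sym p) (c # ds @ [w])"
    using ev_Mu.IH(1)[of "c # ds"] cl c ev_Mu.prems(2) by auto
  then have "I (graph_sym (Mu p)) (ds @ [c])"
    using ev_Mu.prems(1)[OF nth_mem[of 2], of "val (ds @ [c, c, w, c])"] search[OF c] len
    by (auto simp: Let_def map_val_vars val_var nth_append)
  then show ?case using c by blast
qed


section \<open>The reduction\<close>

text \<open>The existence axioms guarantee representatives of all numbers. In the clause for
  \<open>U\<close>, \<open>var 2\<close> is the halting value of \<open>p\<close>; universally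
  quantified in front, it asserts that halting with any value suffices.\<close>

definition axiom_list :: "recf \<Rightarrow> form list" where
  "axiom_list p =
     [Exists (var 0) (Atom zero_sym [var 0]),
      All (var 0) (Exists (var 1) (Atom succ_sym [var 0, var 1]))]
     @ map closure
        (Imp (Atom upper_sym [var 0]) (Imp (Atom (graph_sym p) [var 0, var 1, var 2])
          (Atom upper_sym [var 1])) # clauses p 2)"

text \<open>The relational substitute for a numeral, expressing \<open>rep\<close>:
  \<open>var n\<close> is reached from a zero through \<open>var 0\<close>, ..., each link having
  its own variable.\<close>

fun numeral_form :: "nat \<Rightarrow> form" where
  "numeral_form 0 = Atom zero_sym [var 0]"
| "numeral_form (Suc n) =
     Exists (var n) (And (numeral_form n) (Atom succ_sym [var n, var (Suc n)]))"

definition reduction :: "recf \<Rightarrow> nat \<Rightarrow> form" where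
  "reduction p x = foldr And (axiom_list p)
     (Exists (var x) (And (numeral_form x) (Atom upper_sym [var x])))"

lemma sem_numeral_form: "sem I t (numeral_form n) \<longleftrightarrow> rep I n (t (var n))"
proof (induction n arbitrary: t)
  case (Suc n)
  have "var n \<noteq> var (Suc n)" by (simp add: var_def)
  then show ?case by (simp add: Suc)
qed simp

lemma sem_reduction:
  "sem I t (reduction p x) \<longleftrightarrow>
     (\<exists>d. I zero_sym [d]) \<and> (\<forall>c. \<exists>d. I succ_sym [c, d]) \<and>
     (\<forall>u v w. I upper_sym [u] \<longrightarrow> I (graph_sym p) [u, v, w] \<longrightarrow> I upper_sym [v]) \<and>
     (\<forall>A\<in>set (clauses p 2). \<forall>t. sem I t A) \<and>
     (\<exists>d. rep I x d \<and> I upper_sym [d])"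
proof -
  have *: "(\<forall>t. P (t (var 0)) (t (var 1)) (t (var 2))) \<longleftrightarrow> (\<forall>u v w. P u v w)" for P :: "'a \<Rightarrow> 'a \<Rightarrow> 'a \<Rightarrow> bool"
  proof
    assume L: "\<forall>t. P (t (var 0)) (t (var 1)) (t (var 2))"
    show "\<forall>u v w. P u v w"
    proof (intro allI)
      fix u v w
      show "P u v w" using spec[OF L, of "val [u, v, w]"] by (simp add: val_var)
    qed
  qed simp
  have "var 0 \<noteq> var 1" by (simp add: var_def)
  then show ?thesis
    using *[of "\<lambda>u v w. I upper_sym [u] \<longrightarrow> I (graph_sym p) [u, v, w] \<longrightarrow> I upper_sym [v]"]
    by (simp add: reduction_def axiom_list_def sem_closure sem_numeral_form)
qed

lemma odd_var: "odd (var i)"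
  by (simp add: var_def)

text \<open>Free variables must be odd as well, since \<open>closure\<close> turns them into bound
  ones.\<close>

definition odd_vars :: "form \<Rightarrow> bool" where
  "odd_vars A \<longleftrightarrow> (\<forall>v\<in>free_vars A \<union> bound_vars A. odd v)"

lemma odd_vars_simps [simp]:
  "odd_vars (Atom p vs) \<longleftrightarrow> (\<forall>v\<in>set vs. odd v)"
  "odd_vars (Imp A B) \<longleftrightarrow> odd_vars A \<and> odd_vars B"
  "odd_vars (foldr Imp As B) \<longleftrightarrow> (\<forall>A\<in>set As. odd_vars A) \<and> odd_vars B"
proof -
  show imp: "odd_vars (Imp A B) \<longleftrightarrow> odd_vars A \<and> odd_vars B" for A B by (auto simp: odd_vars_def)
  show "odd_vars (foldr Imp As B) \<longleftrightarrow> (\<forall>A\<in>set As. odd_vars A) \<and> odd_vars B"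
    by (induction As) (auto simp: imp)
qed (simp add: odd_vars_def)

lemma odd_vars_clauses: "A \<in> set (clauses q k) \<Longrightarrow> odd_vars A"
  by (induction q arbitrary: k A) (fastforce simp: Let_def odd_var vars_def split: if_splits)+

lemma separated_closure: "odd_vars A \<Longrightarrow> separated (closure A)"
  by (auto simp: odd_vars_def separated_def free_vars_closure bound_vars_closure)

lemma vars_numeral_form:
  "free_vars (numeral_form n) = {var n}" "\<forall>v\<in>bound_vars (numeral_form n). odd v"
  by (induction n) (auto simp: Exists_def And_def var_def)

lemma separated_And [simp]: "separated (And A B) \<longleftrightarrow> separated A \<and> separated B"
  by (simp add: And_def)

lemma separated_foldr_And [simp]:
  "separated (foldr And As B) \<longleftrightarrow> (\<forall>A\<in>set As. separated A) \<and> separated B"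
  by (induction As) auto

lemma separated_reduction: "separated (reduction p x)"
proof -
  have "separated (Exists (var x) (And (numeral_form x) (Atom upper_sym [var x])))"
    using vars_numeral_form[of x] odd_var
    by (auto simp: separated_def Exists_def And_def)
  moreover have "separated (Exists (var 0) (Atom zero_sym [var 0]))"
    "separated (All (var 0) (Exists (var 1) (Atom succ_sym [var 0, var 1])))"
    using odd_var by (auto simp: separated_def Exists_def)
  ultimately show ?thesis
    by (auto simp: reduction_def axiom_list_def odd_var
        intro!: separated_closure intro: odd_vars_clauses)
qed

lemma code_And: "code (And A B) = code_Neg (code_Imp (code A) (code_Neg (code B)))"
  by (simp add: And_def code_eqs del: code.simps)

lemma code_Exists: "code (Exists x A) = code_Neg (code_All x (code_Neg (code A)))"
  by (simp add: Exists_def code_eqs del: code.simps)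

text \<open>With \<open>p\<close> fixed the axioms are a constant prefix; only the numeral depends
  on \<open>x\<close>, and its code obeys a primitive recursion.\<close>

lemma computable_reduction: "computable (\<lambda>x. code (reduction p x))"
proof -
  let ?s = "\<lambda>n. code_Atom succ_sym (code_Cons (2 * n + 1) (code_Cons (2 * Suc n + 1) 0))"
  \<comment> \<open>\<open>?g y n\<close> is the code of \<open>numeral_form (Suc n)\<close> when
    \<open>y\<close> is that of \<open>numeral_form n\<close>.\<close>
  let ?g = "\<lambda>y n. code_Neg (code_All (2 * n + 1) (code_Neg
      (code_Neg (code_Imp y (code_Neg (?s n))))))"
  have "computable (\<lambda>z. ?g (pi1 z) (pi2 z))"
    by (intro computable_intros computable_code_intros)
  then have "computable2 ?g" by (rule computable2I) simp
  then have rec: "computable (rec_nat (code (numeral_form 0)) (\<lambda>n y. ?g y n))"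
    by (rule computable_rec)
  have "(\<lambda>n. code (numeral_form n)) = rec_nat (code (numeral_form 0)) (\<lambda>n y. ?g y n)"
  proof
    show "code (numeral_form n) = rec_nat (code (numeral_form 0)) (\<lambda>n y. ?g y n) n" for n
      by (induction n)
        (simp_all add: code_Exists code_And code_eqs var_def del: code.simps list_encode.simps
          add: list_encode.simps(1))
  qed
  then have num: "computable (\<lambda>n. code (numeral_form n))" using rec by simp
  have "computable (\<lambda>x. code_Neg (code_All (2 * x + 1) (code_Neg (code_Neg
      (code_Imp (code (numeral_form x))
        (code_Neg (code_Atom upper_sym (code_Cons (2 * x + 1) 0))))))))"
    by (intro computable_intros computable_code_intros num)
  then have body: "computable (\<lambda>x. code (Exists (var x)
      (And (numeral_form x) (Atom upper_sym [var x]))))"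
    by (simp add: code_Exists code_And code_eqs var_def del: code.simps list_encode.simps
          add: list_encode.simps(1))
  have "computable (\<lambda>x. code (foldr And As (f x)))" if "computable (\<lambda>x. code (f x))" for As f
  proof (induction As)
    case (Cons A As)
    then show ?case
      unfolding foldr.simps o_apply code_And
      by (intro computable_code_intros computable_const)
  qed (simp add: that)
  from this[OF body] show ?thesis unfolding reduction_def .
qed

theorem reduction_correct:
  assumes "preorder_on UNIV P" and p: "\<And>x y. (x, y) \<in> P \<longleftrightarrow> (\<exists>z. ev p [x, y] z)"
  shows "(x, y) \<in> P \<longleftrightarrow> \<turnstile> Imp (reduction p x) (reduction p y)"
proof
  assume "(x, y) \<in> P"
  then obtain z where z: "ev p [x, y] z" using p by blast
  show "\<turnstile> Imp (reduction p x) (reduction p y)"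
  proof (rule completeness)
    show "separated (Imp (reduction p x) (reduction p y))" by (simp add: separated_reduction)
    fix I :: "nat \<Rightarrow> nat list \<Rightarrow> bool" and s
    have "\<exists>d. rep I y d \<and> I upper_sym [d]" if x: "sem I s (reduction p x)"
    proof -
      note x = x[unfolded sem_reduction]
      obtain d where d: "rep I x d" "I upper_sym [d]" using x by blast
      obtain d' where d': "rep I y d'" using rep_total[of I y] x by blast
      \<comment> \<open>Any representatives of \<open>x\<close> and \<open>y\<close> will do; the
        one of \<open>x\<close> is chosen in \<open>U\<close>, and the clause for \<open>U\<close>
        then carries membership to \<open>d'\<close>.\<close>
      have "\<exists>e. rep I z e \<and> I (graph_sym p) ([d, d'] @ [e])"
        by (rule rep_graph[OF z]) (use x d d' in \<open>auto simp: numeral_2_eq_2\<close>)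
      then have "I upper_sym [d']" using x d(2) by auto
      then show ?thesis using d' by blast
    qed
    then show "sem I s (Imp (reduction p x) (reduction p y))"
      unfolding sem.simps sem_reduction by blast
  qed
next
  assume "\<turnstile> Imp (reduction p x) (reduction p y)"
  let ?I = "std (\<lambda>z. (x, z) \<in> P)"
  have P: "(x, x) \<in> P" "\<And>u v. (x, u) \<in> P \<Longrightarrow> (u, v) \<in> P \<Longrightarrow> (x, v) \<in> P"
    using assms(1) by (simp_all add: preorder_on_def refl_on_def) (meson transD)
  have graph: "?I (graph_sym p) [u, v, w] \<longleftrightarrow> ev p [u, v] w" for u v w
    using std_simps(4)[of _ p "[u, v]" w] by simp
  have red: "sem ?I t (reduction p z) \<longleftrightarrow> (x, z) \<in> P" for t z
  proof -
    \<comment> \<open>Transitivity is the clause for \<open>U\<close> in this structure, since a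
      computation of \<open>p\<close> on \<open>u\<close> and \<open>v\<close> certifies
      \<open>(u, v) \<in> P\<close>.\<close>
    have "(x, v) \<in> P" if "(x, u) \<in> P" "ev p [u, v] w" for u v w
      using P(2) p that by blast
    then show ?thesis
      unfolding sem_reduction graph rep_std by (auto simp: std_simps std_clauses)
  qed
  show "(x, y) \<in> P"
    using soundness[OF \<open>\<turnstile> Imp (reduction p x) (reduction p y)\<close>, of ?I] red P(1) by simp
qed

theorem theorem4p1:
  "complete_sigma01_preorder logical_implication \<and>
   (\<forall>P. sigma01_preorder P \<longrightarrow>
      (\<exists>f :: nat \<Rightarrow> form. computable (\<lambda>x. code (f x)) \<and>
         (\<forall>x y. (x, y) \<in> P \<longleftrightarrow> \<turnstile> Imp (f x) (f y))))"
proof -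
  have *: "\<exists>f :: nat \<Rightarrow> form. computable (\<lambda>x. code (f x)) \<and>
      (\<forall>x y. (x, y) \<in> P \<longleftrightarrow> \<turnstile> Imp (f x) (f y))" if "sigma01_preorder P" for P
    using that computable_reduction reduction_correct[of P]
    unfolding sigma01_preorder_def re_rel_def by metis
  have "(code A, code B) \<in> logical_implication \<longleftrightarrow> \<turnstile> Imp A B" for A B
    unfolding logical_implication_def using inj_code by (auto dest: injD)
  then have "P \<le>\<^sub>c logical_implication" if "sigma01_preorder P" for P
    unfolding reducible_def using *[OF that] by metis
  then show ?thesis
    unfolding complete_sigma01_preorder_def
    using * sigma01_preorder_logical_implication by blast
qed

end
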